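(* Let $n\ge 2$ be an integer, let $\mu_{NC^{(B)}(n-1,1)}$ be the Möbius function of the poset $NC^{(B)}(n-1,1)$, and let $\widehat{0},\widehat{1}$ be the minimal and maximal element of $NC^{(B)}(n-1,1)$, respectively. Then $$\mu_{NC^{(B)}(n-1,1)}(\widehat{0},\widehat{1}) = (-1)^n\cdot\binom{2n-1}{n}\cdot\frac{5n-4}{4n-2}.$$
   Context: Let $p,q$ be positive integers and $N = p+q$ (in the claim, $p=n-1$, $q=1$, $N=n$). The hyperoctahedral group $B_N$ is the group of permutations $\tau$ of $\{\pm 1,\ldots,\pm N\}$ with $\tau(-i) = -\tau(i)$ for $1\le i\le N$. It is generated by the set consisting of the elements $(i,j)(-i,-j)$ and $(i,-j)(-i,j)$ for $1\le i,j\le N$, $i\neq j$, and the elements $(i,-i)$ for $1\le i\le N$. For $\tau\in B_N$, let $\ell_B(\tau)$ be the smallest $k\ge 0$ such that $\tau$ is a product of $k$ of these generators (the empty product being the identity). The partial order on $B_N$ is: $\tau\le\sigma$ if and only if $\ell_B(\sigma)=\ell_B(\tau)+\ell_B(\tau^{-1}\sigma)$. Let $\gamma_{p,q}\in B_N$ be the permutation with two cycles $$\gamma_{p,q} = (1,\ldots,p,-1,\ldots,-p)\,(p+1,\ldots,p+q,-(p+1),\ldots,-(p+q)),$$ and let $\mathcal{S}^{(B)}_{nc}(p,q) = \{\tau\in B_N \mid \tau\le\gamma_{p,q}\}$. For $\tau\in B_N$, let $\Omega(\tau)$ be the partition of $\{\pm1,\ldots,\pm N\}$ into orbits of $\tau$,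 and let $\widetilde{\Omega}(\tau)$ be the partition obtained from $\Omega(\tau)$ by merging all inversion-invariant blocks (blocks $A$ with $A=-A$), if any exist, into one single block. Define $NC^{(B)}(p,q) = \{\widetilde{\Omega}(\tau)\mid \tau\in \mathcal{S}^{(B)}_{nc}(p,q)\}$, partially ordered by $\pi\le\rho$ if and only if every block of $\pi$ is contained in a block of $\rho$. Its minimal element $\widehat{0}$ is the partition into $2(p+q)$ singletons and its maximal element $\widehat{1}$ is the partition with only one block. *)

theory Defs
  imports Complex_Main "HOL-Library.Disjoint_Sets" "HOL-Combinatorics.Combinatorics"
begin

section \<open>The hyperoctahedral group\<close>

definition signed_points :: "nat \<Rightarrow> int set" where
  "signed_points N = {i. i \<noteq> 0 \<and> \<bar>i\<bar> \<le> int N}"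

text \<open>Elements are represented as functions on all integers that are the identity off
  \<open>signed_points N\<close>; the group operation is composition.\<close>

definition hyperoctahedral :: "nat \<Rightarrow> (int \<Rightarrow> int) set" where
  "hyperoctahedral N =
     {\<tau>. \<tau> permutes signed_points N \<and> (\<forall>i\<in>signed_points N. \<tau> (- i) = - \<tau> i)}"

definition B_generators :: "nat \<Rightarrow> (int \<Rightarrow> int) set" where
  "B_generators N =
     {transpose i j \<circ> transpose (- i) (- j) | i j. i \<in> {1..int N} \<and> j \<in> {1..int N} \<and> i \<noteq> j} \<union>
     {transpose i (- j) \<circ> transpose (- i) j | i j. i \<in> {1..int N} \<and> j \<in> {1..int N} \<and> i \<noteq> j} \<union>
     {transpose i (- i) | i. i \<in> {1..int N}}"

definition B_length :: "nat \<Rightarrow> (int \<Rightarrow> int) \<Rightarrow> nat" where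
  "B_length N \<tau> =
     (LEAST k. \<exists>gs. length gs = k \<and> set gs \<subseteq> B_generators N \<and> \<tau> = foldr (\<circ>) gs id)"

definition B_le :: "nat \<Rightarrow> (int \<Rightarrow> int) \<Rightarrow> (int \<Rightarrow> int) \<Rightarrow> bool" where
  "B_le N \<tau> \<sigma> \<longleftrightarrow> B_length N \<sigma> = B_length N \<tau> + B_length N (inv \<tau> \<circ> \<sigma>)"


section \<open>Annular non-crossing partitions of type B\<close>

text \<open>\<open>cycle_of_list [x\<^sub>1, \<dots>, x\<^sub>m]\<close> maps each \<open>x\<^sub>k\<close> to \<open>x\<^sub>k\<^sub>+\<^sub>1\<close> and \<open>x\<^sub>m\<close> to \<open>x\<^sub>1\<close>.\<close>

definition B_gamma :: "nat \<Rightarrow> nat \<Rightarrow> int \<Rightarrow> int" where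
  "B_gamma p q =
     cycle_of_list ([1..int p] @ map uminus [1..int p]) \<circ>
     cycle_of_list ([int p + 1..int (p + q)] @ map uminus [int p + 1..int (p + q)])"

definition S_nc_B :: "nat \<Rightarrow> nat \<Rightarrow> (int \<Rightarrow> int) set" where
  "S_nc_B p q = {\<tau> \<in> hyperoctahedral (p + q). B_le (p + q) \<tau> (B_gamma p q)}"

definition Omega :: "nat \<Rightarrow> (int \<Rightarrow> int) \<Rightarrow> int set set" where
  "Omega N \<tau> = orbit \<tau> ` signed_points N"

definition Omega_tilde :: "nat \<Rightarrow> (int \<Rightarrow> int) \<Rightarrow> int set set" where
  "Omega_tilde N \<tau> =
     (let Z = {A \<in> Omega N \<tau>. uminus ` A = A}
      in if Z = {} then Omega N \<tau> else insert (\<Union>Z) (Omega N \<tau> - Z))"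

definition NC_B :: "nat \<Rightarrow> nat \<Rightarrow> int set set set" where
  "NC_B p q = Omega_tilde (p + q) ` S_nc_B p q"

definition NC_B_order :: "nat \<Rightarrow> nat \<Rightarrow> int set set rel" where
  "NC_B_order p q =
     {(\<pi>, \<rho>). \<pi> \<in> NC_B p q \<and> \<rho> \<in> NC_B p q \<and> (\<forall>A\<in>\<pi>. \<exists>B\<in>\<rho>. A \<subseteq> B)}"

definition NC_B_zero :: "nat \<Rightarrow> nat \<Rightarrow> int set set" where
  "NC_B_zero p q = (\<lambda>i. {i}) ` signed_points (p + q)"

definition NC_B_one :: "nat \<Rightarrow> nat \<Rightarrow> int set set" where
  "NC_B_one p q = {signed_points (p + q)}"


section \<open>The Moebius function of a finite poset\<close>

text \<open>The guard ensures termination; outside finite posets the value is \<open>0\<close> by convention.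
  That it holds for \<open>NC_B p q\<close> is shown at the end of this theory.\<close>

function moebius :: "'a set \<Rightarrow> 'a rel \<Rightarrow> 'a \<Rightarrow> 'a \<Rightarrow> int" where
  "moebius P r x y =
     (if finite P \<and> partial_order_on P r \<and> (x, y) \<in> r
      then if x = y then 1
           else - (\<Sum>z \<in> {z. (x, z) \<in> r \<and> (z, y) \<in> r \<and> z \<noteq> y}. moebius P r x z)
      else 0)"
  by pat_completeness auto
termination
proof (relation "Wellfounded.measure (\<lambda>(P, r, x, y). card {z. (z, y) \<in> r})", simp)
  fix P :: "'a set" and r :: "'a rel" and x y z
  assume a: "finite P \<and> partial_order_on P r \<and> (x, y) \<in> r"
    and z: "z \<in> {z. (x, z) \<in> r \<and> (z, y) \<in> r \<and> z \<noteq> y}"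
  then have po: "r \<subseteq> P \<times> P" "refl_on P r" "trans r" "antisym r"
    using partial_order_onD by blast+
  have "finite {w. (w, y) \<in> r}"
    using a po(1) by (auto intro: finite_subset[of _ P])
  moreover have "{w. (w, z) \<in> r} \<subset> {w. (w, y) \<in> r}"
  proof
    show "{w. (w, z) \<in> r} \<subseteq> {w. (w, y) \<in> r}"
      using z po(3) by (auto dest: transD)
    have "(y, y) \<in> r" "(y, z) \<notin> r"
      using z po by (auto simp: refl_on_def dest: antisymD)
    then show "{w. (w, z) \<in> r} \<noteq> {w. (w, y) \<in> r}"
      by blast
  qed
  ultimately show "((P, r, x, z), (P, r, x, y))
      \<in> Wellfounded.measure (\<lambda>(P, r, x, y). card {z. (z, y) \<in> r})"
    by (simp add: psubset_card_mono)
qed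

declare moebius.simps [simp del]


section \<open>\<open>NC_B p q\<close> is a finite poset\<close>

lemma finite_signed_points: "finite (signed_points N)"
  by (rule finite_subset[of _ "{- int N..int N}"]) (auto simp: signed_points_def)

lemma partition_on_Omega:
  assumes "\<tau> permutes signed_points N"
  shows "partition_on (signed_points N) (Omega N \<tau>)"
proof -
  have perm: "permutation \<tau>"
    using assms finite_signed_points permutation_permutes by blast
  have self: "x \<in> orbit \<tau> x" for x
    using perm by (rule permutation_self_in_orbit)
  have cyc: "orbit \<tau> y = orbit \<tau> x" if "y \<in> orbit \<tau> x" for x y
    using that self orbit_cyclic_eq3 cyclic_on_orbit'[OF perm] by metis
  have sub: "orbit \<tau> x \<subseteq> signed_points N" if "x \<in> signed_points N" for x
    using permutes_orbit_subset[OF assms that] .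
  show ?thesis
  proof (rule partition_onI)
    show "\<Union> (Omega N \<tau>) = signed_points N"
      using self sub unfolding Omega_def by blast
    show "disjnt A B" if "A \<in> Omega N \<tau>" "B \<in> Omega N \<tau>" "A \<noteq> B" for A B
      using that cyc unfolding Omega_def disjnt_def by blast
    show "{} \<notin> Omega N \<tau>"
      using self unfolding Omega_def by blast
  qed
qed

lemma partition_on_Omega_tilde:
  assumes "\<tau> permutes signed_points N"
  shows "partition_on (signed_points N) (Omega_tilde N \<tau>)"
proof -
  define Z where "Z = {A \<in> Omega N \<tau>. uminus ` A = A}"
  have po: "\<Union> (Omega N \<tau>) = signed_points N" "disjoint (Omega N \<tau>)" "{} \<notin> Omega N \<tau>"
    using partition_on_Omega[OF assms] by (auto simp: partition_on_def)
  have ZO: "Z \<subseteq> Omega N \<tau>"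
    by (auto simp: Z_def)
  show ?thesis
  proof (cases "Z = {}")
    case True
    then show ?thesis
      using partition_on_Omega[OF assms] by (simp add: Omega_tilde_def Z_def[symmetric])
  next
    case False
    have "partition_on (signed_points N) (insert (\<Union>Z) (Omega N \<tau> - Z))"
    proof (rule partition_onI)
      show "\<Union> (insert (\<Union>Z) (Omega N \<tau> - Z)) = signed_points N"
        using ZO unfolding po(1)[symmetric] Union_insert Union_Un_distrib[symmetric]
        by (simp add: Un_absorb1)
      obtain A where "A \<in> Z"
        using False by blast
      moreover have "A \<noteq> {}"
        using \<open>A \<in> Z\<close> po(3) ZO by blast
      ultimately have "\<Union>Z \<noteq> {}"
        by blast
      then show "{} \<notin> insert (\<Union>Z) (Omega N \<tau> - Z)"
        using po(3) by simp
      have 1: "disjnt A (\<Union>Z)" if "A \<in> Omega N \<tau> - Z" for A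
      proof -
        have "A \<inter> B = {}" if "B \<in> Z" for B
          using \<open>A \<in> Omega N \<tau> - Z\<close> that ZO by (intro disjointD[OF po(2)]) auto
        then show ?thesis
          by (auto simp: disjnt_def)
      qed
      show "disjnt A B" if "A \<in> insert (\<Union>Z) (Omega N \<tau> - Z)"
        "B \<in> insert (\<Union>Z) (Omega N \<tau> - Z)" "A \<noteq> B" for A B
        using that 1 disjointD[OF po(2), of A B] by (auto simp: disjnt_def)
    qed
    then show ?thesis
      using False by (simp add: Omega_tilde_def Z_def[symmetric])
  qed
qed

lemma partition_on_NC_B:
  assumes "\<pi> \<in> NC_B p q"
  shows "partition_on (signed_points (p + q)) \<pi>"
  using assms partition_on_Omega_tilde
  by (auto simp: NC_B_def S_nc_B_def hyperoctahedral_def)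

lemma finite_NC_B: "finite (NC_B p q)"
proof -
  have "NC_B p q \<subseteq> {\<pi>. partition_on (signed_points (p + q)) \<pi>}"
    using partition_on_NC_B by blast
  also have "\<dots> \<subseteq> Pow (Pow (signed_points (p + q)))"
    by (auto simp: partition_on_def)
  finally show ?thesis
    by (rule finite_subset) (simp add: finite_signed_points)
qed

lemma NC_B_order_iff_refines:
  "(\<pi>, \<rho>) \<in> NC_B_order p q \<longleftrightarrow>
     \<pi> \<in> NC_B p q \<and> \<rho> \<in> NC_B p q \<and> refines (signed_points (p + q)) \<pi> \<rho>"
  using partition_on_NC_B by (auto simp: NC_B_order_def refines_def)

lemma partial_order_on_NC_B: "partial_order_on (NC_B p q) (NC_B_order p q)"
  unfolding partial_order_on_def preorder_on_def
proof (intro conjI)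
  show "NC_B_order p q \<subseteq> NC_B p q \<times> NC_B p q"
    by (auto simp: NC_B_order_def)
  show "refl_on (NC_B p q) (NC_B_order p q)"
    by (auto simp: refl_on_def NC_B_order_def)
  show "trans (NC_B_order p q)"
    by (rule transI) (auto simp: NC_B_order_iff_refines intro: refines_trans)
  show "antisym (NC_B_order p q)"
  proof (rule antisymI)
    fix \<pi> \<rho>
    assume "(\<pi>, \<rho>) \<in> NC_B_order p q" "(\<rho>, \<pi>) \<in> NC_B_order p q"
    then show "\<pi> = \<rho>"
      unfolding NC_B_order_iff_refines by (elim conjE) (rule refines_asym)
  qed
qed

end

theory Submission
  imports Defs "HOL-Library.Numeral_Type" "HOL-Library.Function_Algebras"
    "HOL-Library.Product_Plus" "HOL-Computational_Algebra.Formal_Power_Series"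
begin

text \<open>
  The poset of annular non-crossing partitions is an interval in the
  absolute order of the hyperoctahedral group in disguise. Let a signed permutation \<open>g\<close> act on the odd
  vectors \<open>v\<close>, those with \<open>v (- i) = - v i\<close>. The blocks of \<open>Omega_tilde N g\<close> are the classes of
  coordinates that agree on every vector fixed by \<open>g\<close>, the merged inversion-invariant block
  being the set of coordinates that vanish on them. So refinement of partitions is reverse
  inclusion of fixed spaces (\<open>Omega_tilde_refines_iff\<close>). The length \<open>B_length N g\<close> is the
  codimension of the fixed space (\<open>B_length_fixed_vectors\<close>), and an argument of Brady and Watt
  shows that below a common upper bound inclusion of fixed spaces is the absolute order
  (\<open>fixed_vectors_absolute_order\<close>, \<open>fixed_vectors_subset_imp_le\<close>). Hence the number to be
  computed is the Moebius function \<open>\<mu>(g)\<close> of the interval from the identity to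
  \<open>g = B_gamma (n - 1) 1\<close>.

  Scalars are taken in the field with three elements. There \<open>v = - v\<close> still forces \<open>v = 0\<close>, so
  fixed spaces have the same dimensions as over the reals, and every dimension count becomes a
  count of elements of finite groups.

  The Moebius function is computed by one recursion, valid for every signed permutation \<open>g\<close> and
  every point \<open>n\<close> that \<open>g\<close> moves (\<open>group_moebius_recursion\<close>): \<open>\<mu>(g)\<close> is minus the sum of
  \<open>\<mu>(t \<circ> g)\<close> over the reflections \<open>t \<le> g\<close> that move \<open>n\<close>. It is an instance of the theorems of
  Weisner and Crapo. Cutting \<open>n\<close> out of the cycle that contains it is an interior operator on the
  interval below \<open>g\<close>; it does not fix the top, so the sum of \<open>\<mu>(y, g)\<close> over the \<open>y\<close> that it sends
  to the identity vanishes, and these \<open>y\<close> are the identity and the reflections that move \<open>n\<close>.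

  A reflection below \<open>g\<close> splits a pair of opposite cycles into two pairs, splits a pair of opposite
  cycles off a self-opposite cycle or turns all of it into such a pair, or merges two
  self-opposite cycles into a pair. For permutations with at most one self-opposite cycle, of
  half-length \<open>k\<close>, the recursion becomes the convolution recursion of \<open>\<surd>(1 + 4 z)\<close> and its
  reciprocal: a pair of cycles of length \<open>l\<close> contributes a signed Catalan number
  \<open>moebius_A l\<close>, and the self-opposite cycle contributes \<open>moebius_B k\<close>, half a signed central
  binomial coefficient (\<open>group_moebius_signed_cycles\<close>). Finally, in
  \<open>B_gamma (n - 1) 1\<close> the inner circle is the single pair \<open>\<plusminus>n\<close>. One step of the recursion
  at \<open>n\<close> gives a term \<open>moebius_B (n - 1)\<close> from the reflection in \<open>n\<close> itself and \<open>2 (n - 1)\<close> equal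
  terms \<open>moebius_A n\<close> from the reflections that merge the two circles
  (\<open>group_moebius_annular\<close>).
\<close>

section \<open>Counting in vector spaces over the field with three elements\<close>

lemma three_cases: "(c::3) = 0 \<or> c = 1 \<or> c = -1"
proof -
  have "card {0, 1, -1 :: 3} = 3" by simp
  then have "{0, 1, -1 :: 3} = UNIV" by (intro card_subset_eq) auto
  then show ?thesis by auto
qed

text \<open>This is where the characteristic matters: an odd vector fixed by a permutation must
  vanish on an inversion-invariant orbit, which fails in characteristic two.\<close>

lemma three_eq_minus_iff: "(c::3) = - c \<longleftrightarrow> c = 0"
  using three_cases[of c] by auto

text \<open>The rank-nullity theorem for finite abelian groups: all non-empty fibres of a
  homomorphism are translates of its kernel.\<close>

lemma card_additive:
  fixes h :: "'a::ab_group_add \<Rightarrow> 'b::ab_group_add"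
  assumes "finite U" "\<And>x y. x \<in> U \<Longrightarrow> y \<in> U \<Longrightarrow> x - y \<in> U"
    and "\<And>x y. x \<in> U \<Longrightarrow> y \<in> U \<Longrightarrow> h (x - y) = h x - h y"
  shows "card U = card {x \<in> U. h x = 0} * card (h ` U)"
proof -
  have fiber: "card {x \<in> U. h x = h y} = card {x \<in> U. h x = 0}" if y: "y \<in> U" for y
  proof (rule bij_betw_same_card)
    have neg: "- z \<in> U" if "z \<in> U" for z
      using assms(2)[OF assms(2)[OF that that] that] by simp
    have add: "x + z \<in> U" if "x \<in> U" "z \<in> U" for x z
      using assms(2)[OF that(1) neg[OF that(2)]] by simp
    have sub: "x - y \<in> U \<and> h (x - y) = h x - h y" if "x \<in> U" for x
      using assms(2,3)[OF that y] by simp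
    have sum: "x + y \<in> U \<and> h (x + y) = h x + h y" if "x \<in> U" for x
      using add[OF that y] assms(3)[OF add[OF that y] y] by simp
    show "bij_betw (\<lambda>x. x - y) {x \<in> U. h x = h y} {x \<in> U. h x = 0}"
      by (rule bij_betw_byWitness[where f' = "\<lambda>x. x + y"]) (auto simp: sub sum)
  qed
  have "card U = (\<Sum>c\<in>h ` U. card {x \<in> U. h x = c})"
    using sum.image_gen[OF assms(1), of "\<lambda>_. 1::nat" h] by simp
  also have "\<dots> = (\<Sum>c\<in>h ` U. card {x \<in> U. h x = 0})"
    using fiber by (intro sum.cong) auto
  finally show ?thesis by simp
qed

section \<open>Odd vectors, reflections and signed permutations\<close>

definition odd_vectors :: "nat \<Rightarrow> (int \<Rightarrow> 3) set" where
  "odd_vectors N = {v. (\<forall>i. v (- i) = - v i) \<and> (\<forall>i. i \<notin> signed_points N \<longrightarrow> v i = 0)}"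

definition fixed_vectors :: "nat \<Rightarrow> (int \<Rightarrow> int) \<Rightarrow> (int \<Rightarrow> 3) set" where
  "fixed_vectors N g = {v \<in> odd_vectors N. v \<circ> g = v}"

definition odd_indicator :: "int set \<Rightarrow> int \<Rightarrow> 3" where
  "odd_indicator S i = (if i \<in> S then 1 else if - i \<in> S then - 1 else 0)"

text \<open>The reflection exchanging \<open>a\<close> with \<open>b\<close> and \<open>- a\<close> with \<open>- b\<close>. The case \<open>b = - a\<close>, the
  sign change of the coordinate \<open>a\<close>, is covered by the same formula, so that the three
  kinds of generators are treated uniformly.\<close>

definition reflection :: "int \<Rightarrow> int \<Rightarrow> int \<Rightarrow> int" where
  "reflection a b k = (if k = a then b else if k = b then a
     else if k = - a then - b else if k = - b then - a else k)"

lemma uminus_signed_points [simp]: "- i \<in> signed_points N \<longleftrightarrow> i \<in> signed_points N"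
  by (simp add: signed_points_def)

lemma signed_points_neq: "i \<in> signed_points N \<Longrightarrow> i \<noteq> - i"
  "i \<in> signed_points N \<Longrightarrow> i \<noteq> 0"
  by (auto simp: signed_points_def)

lemma hyperoctahedralD:
  assumes "g \<in> hyperoctahedral N"
  shows "g (- i) = - g i" "bij g" "g i \<in> signed_points N \<longleftrightarrow> i \<in> signed_points N"
    "i \<notin> signed_points N \<Longrightarrow> g i = i"
proof -
  have g: "g permutes signed_points N" "\<forall>i\<in>signed_points N. g (- i) = - g i"
    using assms by (auto simp: hyperoctahedral_def)
  show "bij g" using g(1) by (rule permutes_bij)
  show "g i \<in> signed_points N \<longleftrightarrow> i \<in> signed_points N"
    using g(1) by (rule permutes_in_image)
  show out: "g i = i" if "i \<notin> signed_points N" for i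
    using g(1) that by (rule permutes_not_in)
  show "g (- i) = - g i"
    using g(2) out[of i] out[of "- i"] by (cases "i \<in> signed_points N") auto
qed

lemma hyperoctahedral_id [simp]: "id \<in> hyperoctahedral N"
  by (auto simp: hyperoctahedral_def permutes_id)

lemma hyperoctahedral_comp [simp]:
  "g \<in> hyperoctahedral N \<Longrightarrow> h \<in> hyperoctahedral N \<Longrightarrow> g \<circ> h \<in> hyperoctahedral N"
  unfolding hyperoctahedral_def by (auto intro: permutes_compose simp: permutes_in_image)

lemma hyperoctahedral_inv [simp]:
  assumes g: "g \<in> hyperoctahedral N" shows "inv g \<in> hyperoctahedral N"
proof -
  have "inv g (- i) = - inv g i" for i
  proof -
    have "g (- inv g i) = - g (inv g i)" using g by (rule hyperoctahedralD)
    also have "g (inv g i) = i"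
      using hyperoctahedralD(2)[OF g] by (simp add: bij_is_surj surj_f_inv_f)
    finally show ?thesis
      using hyperoctahedralD(2)[OF g] by (metis bij_inv_eq_iff)
  qed
  moreover have "inv g permutes signed_points N"
    using g permutes_inv unfolding hyperoctahedral_def by blast
  ultimately show ?thesis by (simp add: hyperoctahedral_def)
qed

lemma hyperoctahedral_cancel [simp]:
  assumes "g \<in> hyperoctahedral N"
  shows "inv g \<circ> g = id" "g \<circ> inv g = id" "inv (inv g) = g"
    "inv g \<circ> (g \<circ> h) = h" "g \<circ> (inv g \<circ> h) = h"
    "inv g (g i) = i" "g (inv g i) = i"
  using hyperoctahedralD(2)[OF assms]
  by (auto simp: bij_is_inj bij_is_surj inv_inv_eq surj_f_inv_f fun_eq_iff)

lemma hyperoctahedral_inv_comp: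
  "g \<in> hyperoctahedral N \<Longrightarrow> h \<in> hyperoctahedral N \<Longrightarrow> inv (g \<circ> h) = inv h \<circ> inv g"
  by (rule o_inv_distrib) (auto dest: hyperoctahedralD)

lemma finite_hyperoctahedral: "finite (hyperoctahedral N)"
  by (rule finite_subset[OF _ finite_permutations[OF finite_signed_points[of N]]])
    (auto simp: hyperoctahedral_def)

lemma reflection_simps [simp]: "reflection a b a = b" "reflection a b b = a"
  "a \<noteq> 0 \<Longrightarrow> b \<noteq> 0 \<Longrightarrow> reflection a b (- a) = - b"
  "a \<noteq> 0 \<Longrightarrow> b \<noteq> 0 \<Longrightarrow> reflection a b (- b) = - a"
  by (auto simp: reflection_def)

lemma reflection_other: "\<bar>k\<bar> \<noteq> \<bar>a\<bar> \<Longrightarrow> \<bar>k\<bar> \<noteq> \<bar>b\<bar> \<Longrightarrow> reflection a b k = k"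
  by (auto simp: reflection_def)

lemma reflection_involution [simp]:
  assumes "a \<noteq> 0" "b \<noteq> 0"
  shows "reflection a b (reflection a b k) = k"
    "reflection a b \<circ> reflection a b = id"
    "reflection a b \<circ> (reflection a b \<circ> h) = h"
  using assms by (auto simp: reflection_def fun_eq_iff)

lemma inv_reflection [simp]: "a \<noteq> 0 \<Longrightarrow> b \<noteq> 0 \<Longrightarrow> inv (reflection a b) = reflection a b"
  by (rule inv_equality) auto

lemma reflection_hyperoctahedral [simp]:
  assumes "a \<in> signed_points N" "b \<in> signed_points N"
  shows "reflection a b \<in> hyperoctahedral N"
proof -
  have nz: "a \<noteq> 0" "b \<noteq> 0" using assms by (auto simp: signed_points_def)
  then have "bij (reflection a b)"
    by (intro o_bij[of "reflection a b"]) auto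
  moreover have "reflection a b i = i" if "i \<notin> signed_points N" for i
    using assms that by (auto simp: reflection_def)
  moreover have "reflection a b (- i) = - reflection a b i" for i
    using nz by (auto simp: reflection_def)
  ultimately show ?thesis
    by (auto simp: hyperoctahedral_def permutes_def bij_iff)
qed

lemma reflection_uminus: "a \<noteq> 0 \<Longrightarrow> b \<noteq> 0 \<Longrightarrow> reflection (- a) (- b) = reflection a b"
  by (auto simp: reflection_def fun_eq_iff)

lemma reflection_eq_transpose:
  assumes "a \<noteq> 0" "b \<noteq> 0"
  shows "\<bar>a\<bar> \<noteq> \<bar>b\<bar> \<Longrightarrow> reflection a b = transpose a b \<circ> transpose (- a) (- b)"
    "reflection a (- a) = transpose a (- a)"
proof -
  show "reflection a (- a) = transpose a (- a)"
    using assms by (intro ext) (simp add: reflection_def transpose_def)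
  assume ne: "\<bar>a\<bar> \<noteq> \<bar>b\<bar>"
  have neq: "a \<noteq> b" "a \<noteq> - b" "a \<noteq> - a" "b \<noteq> - b"
    using assms ne by auto
  show "reflection a b = transpose a b \<circ> transpose (- a) (- b)"
  proof
    fix k
    consider "k = a" | "k = b" | "k = - a" | "k = - b" | "k \<noteq> a" "k \<noteq> b" "k \<noteq> - a" "k \<noteq> - b"
      by blast
    then show "reflection a b k = (transpose a b \<circ> transpose (- a) (- b)) k"
      by cases (use neq assms in \<open>simp_all add: reflection_def transpose_apply_other\<close>)
  qed
qed

lemma B_generators_eq:
  "B_generators N = {reflection a b | a b. a \<in> signed_points N \<and> b \<in> signed_points N \<and> a \<noteq> b}"
  (is "_ = ?R")
proof -
  have pos: "i \<noteq> 0" "i \<in> signed_points N" "- i \<in> signed_points N" "i \<noteq> - i" "\<bar>i\<bar> = i"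
    if "i \<in> {1..int N}" for i
    using that by (auto simp: signed_points_def)
  have eq: "transpose i j \<circ> transpose (- i) (- j) = reflection i j"
    "transpose i (- j) \<circ> transpose (- i) j = reflection i (- j)" "i \<noteq> - j"
    if "i \<in> {1..int N}" "j \<in> {1..int N}" "i \<noteq> j" for i j
  proof -
    have "i \<noteq> 0" "j \<noteq> 0" "- j \<noteq> 0" "\<bar>i\<bar> \<noteq> \<bar>j\<bar>" "\<bar>i\<bar> \<noteq> \<bar>- j\<bar>"
      using that by auto
    then show "transpose i j \<circ> transpose (- i) (- j) = reflection i j"
      "transpose i (- j) \<circ> transpose (- i) j = reflection i (- j)" "i \<noteq> - j"
      using reflection_eq_transpose(1)[of i j] reflection_eq_transpose(1)[of i "- j"]
      unfolding minus_minus by metis+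
  qed
  have eq': "transpose i (- i) = reflection i (- i)" if "i \<in> {1..int N}" for i
    using reflection_eq_transpose(2)[of i i] pos(1)[OF that] by metis
  show ?thesis
  proof (intro equalityI subsetI)
    fix t assume "t \<in> B_generators N"
    then show "t \<in> ?R"
      unfolding B_generators_def
    proof (elim UnE CollectE exE conjE)
      fix i j assume "t = transpose i j \<circ> transpose (- i) (- j)"
        "i \<in> {1..int N}" "j \<in> {1..int N}" "i \<noteq> j"
      then show "t \<in> ?R" using eq(1) pos(2) by blast
    next
      fix i j assume "t = transpose i (- j) \<circ> transpose (- i) j"
        "i \<in> {1..int N}" "j \<in> {1..int N}" "i \<noteq> j"
      then show "t \<in> ?R" using eq(2,3) pos(2,3) by blast
    next
      fix i assume "t = transpose i (- i)" "i \<in> {1..int N}"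
      then show "t \<in> ?R" using eq' pos(2,3,4) by blast
    qed
  next
    fix t assume "t \<in> ?R"
    then obtain a b where ab: "a \<in> signed_points N" "b \<in> signed_points N" "a \<noteq> b"
        "t = reflection a b"
      by blast
    define i j where "i = \<bar>a\<bar>" and "j = \<bar>b\<bar>"
    have ij: "i \<in> {1..int N}" "j \<in> {1..int N}"
      using ab unfolding i_def j_def by (auto simp: signed_points_def)
    have "reflection i j \<in> B_generators N" if "i \<noteq> j"
      unfolding B_generators_def eq(1)[OF ij that, symmetric] using ij that by blast
    moreover have "reflection i (- j) \<in> B_generators N" if "i \<noteq> j"
      unfolding B_generators_def eq(2)[OF ij that, symmetric] using ij that by blast
    moreover have "reflection i (- i) \<in> B_generators N"
      unfolding B_generators_def eq'[OF ij(1), symmetric] using ij by blast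
    moreover have "reflection (- i) (- j) = reflection i j" "reflection (- i) j = reflection i (- j)"
      "reflection (- i) i = reflection i (- i)"
      using pos(1)[OF ij(1)] pos(1)[OF ij(2)] reflection_uminus[of i j]
        reflection_uminus[of i "- j"] reflection_uminus[of i "- i"] by simp_all
    moreover have "a = i \<or> a = - i" "b = j \<or> b = - j"
      unfolding i_def j_def by linarith+
    ultimately show "t \<in> B_generators N"
      using ab(3,4) by (cases "i = j") auto
  qed
qed

lemma finite_odd_vectors: "finite (odd_vectors N)"
proof (rule finite_subset)
  show "odd_vectors N \<subseteq> {v. \<forall>i. (i \<in> signed_points N \<longrightarrow> v i \<in> UNIV) \<and> (i \<notin> signed_points N \<longrightarrow> v i = 0)}"
    by (auto simp: odd_vectors_def)
qed (intro finite_set_of_finite_funs finite_signed_points finite)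

lemma odd_vectorsD: "v \<in> odd_vectors N \<Longrightarrow> v (- i) = - v i"
  "v \<in> odd_vectors N \<Longrightarrow> i \<notin> signed_points N \<Longrightarrow> v i = 0"
  by (auto simp: odd_vectors_def)

lemma odd_vectors_diff [intro]:
  "u \<in> odd_vectors N \<Longrightarrow> v \<in> odd_vectors N \<Longrightarrow> u - v \<in> odd_vectors N"
  by (auto simp: odd_vectors_def)

lemma zero_odd_vector [simp]: "0 \<in> odd_vectors N"
  by (auto simp: odd_vectors_def)

lemma odd_vectors_comp:
  assumes "g \<in> hyperoctahedral N" "v \<in> odd_vectors N"
  shows "v \<circ> g \<in> odd_vectors N"
  using assms hyperoctahedralD[OF assms(1)] by (auto simp: odd_vectors_def)

lemma diff_comp: "((u :: int \<Rightarrow> 3) - v) \<circ> g = (u \<circ> g) - (v \<circ> g)"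
  by (simp add: fun_eq_iff)

lemma fixed_vectorsD: "v \<in> fixed_vectors N g \<Longrightarrow> v \<in> odd_vectors N"
  "v \<in> fixed_vectors N g \<Longrightarrow> v (g i) = v i"
  by (auto simp: fixed_vectors_def fun_eq_iff)

lemma fixed_vectors_diff [intro]:
  "u \<in> fixed_vectors N g \<Longrightarrow> v \<in> fixed_vectors N g \<Longrightarrow> u - v \<in> fixed_vectors N g"
  by (auto simp: fixed_vectors_def diff_comp)

lemma zero_fixed_vector [simp]: "0 \<in> fixed_vectors N g"
  by (auto simp: fixed_vectors_def fun_eq_iff)

lemma finite_fixed_vectors [simp]: "finite (fixed_vectors N g)"
  by (rule finite_subset[OF _ finite_odd_vectors[of N]]) (auto simp: fixed_vectors_def)

lemma card_fixed_vectors_pos: "card (fixed_vectors N g) > 0"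
  using zero_fixed_vector[of N g] finite_fixed_vectors[of N g] card_gt_0_iff by blast

lemma fixed_vectors_id [simp]: "fixed_vectors N id = odd_vectors N"
  by (auto simp: fixed_vectors_def)

text \<open>The vectors on which \<open>g\<close> and \<open>h\<close> agree are carried to the fixed vectors of \<open>inv g \<circ> h\<close>
  by precomposition with \<open>g\<close>. With the count of fixed vectors this makes the distance of
  \<open>g\<close> and \<open>h\<close> visible in the space of vectors on which they agree.\<close>

lemma card_eq_vectors:
  assumes "g \<in> hyperoctahedral N" "h \<in> hyperoctahedral N"
  shows "card {v \<in> odd_vectors N. v \<circ> g = v \<circ> h} = card (fixed_vectors N (inv g \<circ> h))"
proof (rule bij_betw_same_card)
  show "bij_betw (\<lambda>v. v \<circ> g) {v \<in> odd_vectors N. v \<circ> g = v \<circ> h} (fixed_vectors N (inv g \<circ> h))"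
  proof (rule bij_betw_byWitness[where f' = "\<lambda>v. v \<circ> inv g"])
    show "\<forall>v \<in> {v \<in> odd_vectors N. v \<circ> g = v \<circ> h}. v \<circ> g \<circ> inv g = v"
      unfolding comp_assoc using assms by simp
    show "\<forall>v \<in> fixed_vectors N (inv g \<circ> h). v \<circ> inv g \<circ> g = v"
      unfolding comp_assoc using assms by simp
    show "(\<lambda>v. v \<circ> g) ` {v \<in> odd_vectors N. v \<circ> g = v \<circ> h} \<subseteq> fixed_vectors N (inv g \<circ> h)"
    proof (clarify)
      fix v assume v: "v \<in> odd_vectors N" "v \<circ> g = v \<circ> h"
      have "v \<circ> g \<circ> (inv g \<circ> h) = v \<circ> g"
        unfolding comp_assoc hyperoctahedral_cancel(5)[OF assms(1)] using v(2) by (rule sym)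
      then show "v \<circ> g \<in> fixed_vectors N (inv g \<circ> h)"
        using assms v(1) by (simp add: fixed_vectors_def odd_vectors_comp)
    qed
    show "(\<lambda>v. v \<circ> inv g) ` fixed_vectors N (inv g \<circ> h) \<subseteq> {v \<in> odd_vectors N. v \<circ> g = v \<circ> h}"
      using assms by (auto simp: fixed_vectors_def odd_vectors_comp comp_assoc)
  qed
qed

lemma card_fixed_vectors_comp_commute:
  assumes "g \<in> hyperoctahedral N" "h \<in> hyperoctahedral N"
  shows "card (fixed_vectors N (g \<circ> h)) = card (fixed_vectors N (h \<circ> g))"
proof (rule bij_betw_same_card)
  have key: "v \<circ> g \<in> fixed_vectors N (h \<circ> g)" if "v \<in> fixed_vectors N (g \<circ> h)"
    "g \<in> hyperoctahedral N" "h \<in> hyperoctahedral N" for v g h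
  proof -
    have "v \<circ> g \<circ> (h \<circ> g) = (v \<circ> (g \<circ> h)) \<circ> g" by (simp add: comp_assoc)
    then show ?thesis using that by (simp add: fixed_vectors_def odd_vectors_comp)
  qed
  show "bij_betw (\<lambda>v. v \<circ> g) (fixed_vectors N (g \<circ> h)) (fixed_vectors N (h \<circ> g))"
    by (rule bij_betw_byWitness[where f' = "\<lambda>v. v \<circ> h"])
      (use key assms in \<open>auto simp: fixed_vectors_def comp_assoc\<close>)
qed

lemma odd_indicator_odd_vector:
  assumes "S \<subseteq> signed_points N" "\<And>i. i \<in> S \<Longrightarrow> - i \<notin> S"
  shows "odd_indicator S \<in> odd_vectors N"
proof -
  have "- i \<in> signed_points N \<Longrightarrow> i \<in> signed_points N" for i by simp
  then show ?thesis
    using assms unfolding odd_vectors_def odd_indicator_def by (fastforce split: if_splits)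
qed

lemma odd_indicator_fixed:
  assumes "g \<in> hyperoctahedral N" "S \<subseteq> signed_points N" "\<And>i. i \<in> S \<Longrightarrow> - i \<notin> S"
    and "g ` S \<subseteq> S"
  shows "odd_indicator S \<in> fixed_vectors N g"
proof -
  have "finite S"
    using assms(2) finite_signed_points finite_subset by blast
  then have "g ` S = S"
    using assms(1,4) hyperoctahedralD(2) by (meson bij_is_inj endo_inj_surj inj_on_subset subset_UNIV)
  then have mem: "g i \<in> S \<longleftrightarrow> i \<in> S" for i
    using hyperoctahedralD(2)[OF assms(1)] by (metis bij_is_inj inj_image_mem_iff)
  have "- g i \<in> S \<longleftrightarrow> - i \<in> S" for i
    using mem[of "- i"] hyperoctahedralD(1)[OF assms(1)] by simp
  then show ?thesis
    using odd_indicator_odd_vector[OF assms(2,3)] mem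
    by (auto simp: fixed_vectors_def odd_indicator_def fun_eq_iff)
qed

lemma fixed_by_reflection:
  assumes "v \<in> odd_vectors N" "v a = v b"
  shows "v (reflection a b k) = v k"
  using assms by (auto simp: reflection_def odd_vectorsD)

lemma fixed_vectors_reflection_comp:
  "{v \<in> fixed_vectors N g. v a = v b} \<subseteq> fixed_vectors N (reflection a b \<circ> g)"
  by (auto simp: fixed_vectors_def fun_eq_iff fixed_by_reflection)

section \<open>The length is the codimension of the fixed space\<close>

text \<open>A reflection changes nothing on the hyperplane \<open>v a = v b\<close>, so one more generator
  costs at most one dimension of fixed vectors. This is what bounds the length of a word
  from below.\<close>

lemma card_fixed_vectors_reflection_comp_ge:
  "card (fixed_vectors N g) \<le> 3 * card (fixed_vectors N (reflection a b \<circ> g))"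
proof -
  let ?h = "\<lambda>v::int \<Rightarrow> 3. v a - v b"
  have "card (fixed_vectors N g) = card {v \<in> fixed_vectors N g. ?h v = 0} * card (?h ` fixed_vectors N g)"
    by (rule card_additive) auto
  also have "\<dots> \<le> card (fixed_vectors N (reflection a b \<circ> g)) * card (UNIV :: 3 set)"
    using fixed_vectors_reflection_comp[of N g a b] by (intro mult_mono card_mono) auto
  finally show ?thesis by simp
qed

text \<open>Composing with the reflection that takes \<open>g n\<close> back to \<open>n\<close> keeps every fixed vector of
  \<open>g\<close> and adds the coordinate vector at \<open>n\<close>; the old fixed vectors are the kernel of
  \<open>v n - v (g n)\<close> on the new ones, so exactly one dimension is gained. This is the
  greedy step that writes \<open>g\<close> as a short word, and it is also the interior operator
  behind the Moebius recursion.\<close>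

lemma card_fixed_vectors_isolate:
  assumes g: "g \<in> hyperoctahedral N" and n: "n \<in> signed_points N" "g n \<noteq> n"
  shows "card (fixed_vectors N (reflection n (g n) \<circ> g)) = 3 * card (fixed_vectors N g)"
proof -
  let ?t = "reflection n (g n)" and ?h = "\<lambda>v::int \<Rightarrow> 3. v n - v (g n)"
  let ?F = "fixed_vectors N (?t \<circ> g)"
  have gn: "g n \<in> signed_points N" and nz: "n \<noteq> 0" "g n \<noteq> 0" and nn: "n \<noteq> - n"
    using n hyperoctahedralD(3)[OF g, of n] by (auto simp: signed_points_def)
  have ker: "{v \<in> ?F. ?h v = 0} = fixed_vectors N g"
  proof (intro equalityI subsetI)
    fix v assume v: "v \<in> {v \<in> ?F. ?h v = 0}"
    then have "v (g i) = v i" for i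
      using fixed_by_reflection[of v N n "g n" "g i"] by (auto simp: fixed_vectors_def fun_eq_iff)
    then show "v \<in> fixed_vectors N g" using v by (auto simp: fixed_vectors_def)
  next
    fix v assume "v \<in> fixed_vectors N g"
    then show "v \<in> {v \<in> ?F. ?h v = 0}"
      using fixed_vectors_reflection_comp[of N g n "g n"] by (auto simp: fixed_vectorsD)
  qed
  let ?e = "odd_indicator {n}"
  have e: "?e \<in> ?F"
    using n nn g gn by (intro odd_indicator_fixed) auto
  have he: "?h ?e \<noteq> 0"
    using n(2) nn by (auto simp: odd_indicator_def)
  have "0 \<in> ?h ` ?F"
    by (rule image_eqI[of _ _ 0]) auto
  moreover have "- ?h ?e \<in> ?h ` ?F"
    using fixed_vectors_diff[OF zero_fixed_vector e] by (intro image_eqI[of _ _ "0 - ?e"]) auto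
  ultimately have "{0, ?h ?e, - ?h ?e} \<subseteq> ?h ` ?F"
    using e by blast
  moreover have "{0, ?h ?e, - ?h ?e} = (UNIV :: 3 set)"
  proof (rule card_subset_eq)
    have "?h ?e \<noteq> - ?h ?e" using he three_eq_minus_iff by blast
    then show "card {0, ?h ?e, - ?h ?e} = card (UNIV :: 3 set)"
      using he by simp
  qed auto
  ultimately have "UNIV \<subseteq> ?h ` ?F" by (rule subst[where P = "\<lambda>A. A \<subseteq> _", rotated])
  then have "card (?h ` ?F) = card (UNIV :: 3 set)" by (simp only: top.extremum_unique)
  moreover have "card ?F = card {v \<in> ?F. ?h v = 0} * card (?h ` ?F)"
    by (rule card_additive) auto
  ultimately show ?thesis using ker by simp
qed

lemma foldr_comp_Cons: "foldr (\<circ>) (t # gs) id = t \<circ> foldr (\<circ>) gs id"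
  by (simp only: foldr.simps comp_apply)

lemma foldr_comp_Nil: "foldr (\<circ>) [] id = id"
  by (simp only: foldr.simps(1) id_def)

lemma foldr_comp_append: "foldr (\<circ>) (gs @ hs) id = foldr (\<circ>) gs id \<circ> foldr (\<circ>) hs id"
proof (induction gs)
  case (Cons t gs)
  then show ?case unfolding append_Cons foldr_comp_Cons by (simp only: comp_assoc)
qed (simp only: append_Nil foldr_comp_Nil id_comp)

lemma word_lower_bound:
  assumes "set gs \<subseteq> B_generators N"
  shows "foldr (\<circ>) gs id \<in> hyperoctahedral N \<and>
    card (odd_vectors N) \<le> 3 ^ length gs * card (fixed_vectors N (foldr (\<circ>) gs id))"
  using assms
proof (induction gs)
  case (Cons t gs)
  from Cons.prems have "t \<in> B_generators N" by simp
  then obtain a b where t: "a \<in> signed_points N" "b \<in> signed_points N" "t = reflection a b"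
    unfolding B_generators_eq by blast
  let ?h = "foldr (\<circ>) gs id"
  have IH: "?h \<in> hyperoctahedral N"
    "card (odd_vectors N) \<le> 3 ^ length gs * card (fixed_vectors N ?h)"
    using Cons.IH Cons.prems by (metis insert_subset list.set(2))+
  have "3 ^ length gs * card (fixed_vectors N ?h)
      \<le> 3 ^ length gs * (3 * card (fixed_vectors N (t \<circ> ?h)))"
    unfolding t(3) by (intro mult_left_mono card_fixed_vectors_reflection_comp_ge) simp
  then have "card (odd_vectors N) \<le> 3 ^ length gs * (3 * card (fixed_vectors N (t \<circ> ?h)))"
    using IH(2) by linarith
  moreover have "t \<circ> ?h \<in> hyperoctahedral N"
    using IH(1) t by simp
  ultimately show ?case
    unfolding foldr_comp_Cons list.size power_Suc2 add_Suc_right add_0_right mult.assoc by blast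
qed simp

text \<open>Undoing \<open>g\<close> point by point, each time gaining one dimension of fixed vectors, gives a
  word whose length meets the lower bound.\<close>

lemma word_upper_bound:
  assumes "g \<in> hyperoctahedral N"
  shows "\<exists>gs. set gs \<subseteq> B_generators N \<and> g = foldr (\<circ>) gs id \<and>
    3 ^ length gs * card (fixed_vectors N g) = card (odd_vectors N)"
  using assms
proof (induction "card (odd_vectors N) - card (fixed_vectors N g)" arbitrary: g rule: less_induct)
  case less
  show ?case
  proof (cases "g = id")
    case True
    then show ?thesis by (intro exI[of _ "[]"]) simp
  next
    case False
    then obtain n where n: "g n \<noteq> n" by (auto simp: fun_eq_iff)
    then have pts: "n \<in> signed_points N" "g n \<in> signed_points N"
      using hyperoctahedralD(3,4)[OF less.prems] by auto
    let ?t = "reflection n (g n)"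
    have c: "card (fixed_vectors N (?t \<circ> g)) = 3 * card (fixed_vectors N g)"
      using card_fixed_vectors_isolate[OF less.prems pts(1) n] .
    have tg: "?t \<circ> g \<in> hyperoctahedral N" using pts less.prems by simp
    have "card (fixed_vectors N (?t \<circ> g)) \<le> card (odd_vectors N)"
      by (intro card_mono finite_odd_vectors) (auto simp: fixed_vectors_def)
    then have "card (odd_vectors N) - card (fixed_vectors N (?t \<circ> g))
        < card (odd_vectors N) - card (fixed_vectors N g)"
      using c card_fixed_vectors_pos[of N g] by linarith
    from less.hyps[OF this tg] obtain gs where gs: "set gs \<subseteq> B_generators N"
        "?t \<circ> g = foldr (\<circ>) gs id"
        "3 ^ length gs * card (fixed_vectors N (?t \<circ> g)) = card (odd_vectors N)"
      by blast
    have nz: "n \<noteq> 0" "g n \<noteq> 0" using pts by (auto simp: signed_points_def)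
    have "g = foldr (\<circ>) (?t # gs) id"
      unfolding foldr_comp_Cons gs(2)[symmetric] using nz by simp
    moreover have "?t \<in> B_generators N" unfolding B_generators_eq using pts n[symmetric] by blast
    ultimately show ?thesis using gs c by (intro exI[of _ "?t # gs"]) simp
  qed
qed

text \<open>Both sides count in the field with three elements, so the equation says that the
  length of \<open>g\<close> is the codimension of its fixed space.\<close>

lemma B_length_fixed_vectors:
  assumes "g \<in> hyperoctahedral N"
  shows "3 ^ B_length N g * card (fixed_vectors N g) = card (odd_vectors N)"
proof -
  let ?P = "\<lambda>k. \<exists>gs. length gs = k \<and> set gs \<subseteq> B_generators N \<and> g = foldr (\<circ>) gs id"
  obtain gs where gs: "set gs \<subseteq> B_generators N" "g = foldr (\<circ>) gs id"
    "3 ^ length gs * card (fixed_vectors N g) = card (odd_vectors N)"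
    using word_upper_bound[OF assms] by blast
  then have "?P (length gs)" by blast
  then have len: "?P (B_length N g)" "B_length N g \<le> length gs"
    unfolding B_length_def by (rule LeastI, rule Least_le)
  then obtain hs where hs: "length hs = B_length N g" "set hs \<subseteq> B_generators N"
      "g = foldr (\<circ>) hs id"
    by (elim exE conjE)
  have "card (odd_vectors N) \<le> 3 ^ B_length N g * card (fixed_vectors N g)"
    using word_lower_bound[OF hs(2)] unfolding hs(1) hs(3)[symmetric] by (rule conjunct2)
  moreover have "3 ^ B_length N g * card (fixed_vectors N g) \<le> card (odd_vectors N)"
    using len(2) unfolding gs(3)[symmetric]
    by (intro mult_right_mono power_increasing) auto
  ultimately show ?thesis by simp
qed

lemma B_length_word:
  assumes "g \<in> hyperoctahedral N"
  obtains gs where "length gs = B_length N g" "set gs \<subseteq> B_generators N" "g = foldr (\<circ>) gs id"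
proof -
  obtain gs where gs: "set gs \<subseteq> B_generators N" "g = foldr (\<circ>) gs id"
    "3 ^ length gs * card (fixed_vectors N g) = card (odd_vectors N)"
    using word_upper_bound[OF assms] by blast
  then have "(3::nat) ^ length gs = 3 ^ B_length N g"
    using B_length_fixed_vectors[OF assms] card_fixed_vectors_pos[of N g]
    by (metis mult_right_cancel less_numeral_extra(3))
  then have "length gs = B_length N g" by simp
  then show thesis using gs that by blast
qed

lemma B_length_le_iff:
  assumes "g \<in> hyperoctahedral N" "h \<in> hyperoctahedral N"
  shows "B_length N g \<le> B_length N h \<longleftrightarrow> card (fixed_vectors N h) \<le> card (fixed_vectors N g)"
proof -
  have *: "card (fixed_vectors N b) < card (fixed_vectors N a)"
    if "B_length N a < B_length N b" "a \<in> hyperoctahedral N" "b \<in> hyperoctahedral N" for a b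
  proof (rule ccontr)
    assume "\<not> ?thesis"
    then have "3 ^ B_length N a * card (fixed_vectors N a) \<le> 3 ^ B_length N a * card (fixed_vectors N b)"
      by simp
    also have "\<dots> < 3 ^ B_length N b * card (fixed_vectors N b)"
      using that(1) card_fixed_vectors_pos[of N b] by simp
    finally show False using that by (simp add: B_length_fixed_vectors)
  qed
  have "card (fixed_vectors N h) = card (fixed_vectors N g)" if "B_length N g = B_length N h"
  proof -
    have "3 ^ B_length N g * card (fixed_vectors N h) = 3 ^ B_length N g * card (fixed_vectors N g)"
      using B_length_fixed_vectors[OF assms(1)] B_length_fixed_vectors[OF assms(2)] that by simp
    then show ?thesis by simp
  qed
  then show ?thesis
    using *[OF _ assms] *[OF _ assms(2,1)] by (metis le_less_linear less_imp_le_nat nat_less_le not_le)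
qed

lemma B_length_le:
  "set gs \<subseteq> B_generators N \<Longrightarrow> B_length N (foldr (\<circ>) gs id) \<le> length gs"
  unfolding B_length_def by (intro Least_le) blast

lemma B_length_comp_le:
  assumes "g \<in> hyperoctahedral N" "h \<in> hyperoctahedral N"
  shows "B_length N (g \<circ> h) \<le> B_length N g + B_length N h"
proof -
  obtain gs where gs: "length gs = B_length N g" "set gs \<subseteq> B_generators N" "g = foldr (\<circ>) gs id"
    using B_length_word[OF assms(1)] .
  obtain hs where hs: "length hs = B_length N h" "set hs \<subseteq> B_generators N" "h = foldr (\<circ>) hs id"
    using B_length_word[OF assms(2)] .
  show ?thesis
    using B_length_le[of "gs @ hs" N] gs hs unfolding foldr_comp_append by simp
qed

lemma B_length_comp_commute:
  assumes "g \<in> hyperoctahedral N" "h \<in> hyperoctahedral N"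
  shows "B_length N (g \<circ> h) = B_length N (h \<circ> g)"
  using card_fixed_vectors_comp_commute[OF assms] assms
  by (intro order_antisym) (simp_all add: B_length_le_iff)

lemma B_length_id [simp]: "B_length N id = 0"
  using B_length_fixed_vectors[of id N] card_fixed_vectors_pos[of N id] by simp

lemma B_length_eq_0: "g \<in> hyperoctahedral N \<Longrightarrow> B_length N g = 0 \<longleftrightarrow> g = id"
  by (metis B_length_id B_length_word foldr.simps(1) id_apply length_0_conv)

lemma B_length_reflection:
  assumes "a \<in> signed_points N" "b \<in> signed_points N" "a \<noteq> b"
  shows "B_length N (reflection a b) = 1"
proof -
  have "reflection a b \<in> B_generators N" using assms unfolding B_generators_eq by blast
  then have "B_length N (reflection a b) \<le> 1"
    using B_length_le[of "[reflection a b]" N] by simp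
  moreover have "reflection a b \<noteq> id" using assms(3) by (metis id_apply reflection_simps(1))
  ultimately show ?thesis using B_length_eq_0[of "reflection a b" N] assms by simp
qed

section \<open>The absolute order\<close>

definition absolute_order :: "nat \<Rightarrow> (int \<Rightarrow> int) rel" where
  "absolute_order N = {(x, y). x \<in> hyperoctahedral N \<and> y \<in> hyperoctahedral N \<and> B_le N x y}"

lemma absolute_orderD:
  assumes "(x, y) \<in> absolute_order N"
  shows "x \<in> hyperoctahedral N" "y \<in> hyperoctahedral N"
    "B_length N y = B_length N x + B_length N (inv x \<circ> y)"
  using assms by (auto simp: absolute_order_def B_le_def)

lemma absolute_order_trans:
  assumes "(x, y) \<in> absolute_order N" "(y, z) \<in> absolute_order N"
  shows "(x, z) \<in> absolute_order N"
proof -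
  note xy = absolute_orderD[OF assms(1)] and yz = absolute_orderD[OF assms(2)]
  have "inv x \<circ> z = (inv x \<circ> y) \<circ> (inv y \<circ> z)"
    unfolding comp_assoc using yz(1) by simp
  then have "B_length N (inv x \<circ> z) \<le> B_length N (inv x \<circ> y) + B_length N (inv y \<circ> z)"
    using B_length_comp_le[of "inv x \<circ> y" N "inv y \<circ> z"] xy yz by simp
  moreover have "B_length N z \<le> B_length N x + B_length N (inv x \<circ> z)"
    using B_length_comp_le[of x N "inv x \<circ> z"] xy yz by simp
  ultimately show ?thesis
    using xy yz by (simp add: absolute_order_def B_le_def)
qed

lemma partial_order_absolute: "partial_order_on (hyperoctahedral N) (absolute_order N)"
  unfolding partial_order_on_def preorder_on_def
proof (intro conjI)
  show "absolute_order N \<subseteq> hyperoctahedral N \<times> hyperoctahedral N"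
    by (auto simp: absolute_order_def)
  show "refl_on (hyperoctahedral N) (absolute_order N)"
    by (auto simp: refl_on_def absolute_order_def B_le_def)
  show "trans (absolute_order N)"
    using absolute_order_trans by (rule transI)
  show "antisym (absolute_order N)"
  proof (rule antisymI)
    fix x y assume a: "(x, y) \<in> absolute_order N" "(y, x) \<in> absolute_order N"
    note xy = absolute_orderD[OF a(1)] and yx = absolute_orderD[OF a(2)]
    have "B_length N (inv x \<circ> y) = 0" using xy(3) yx(3) by simp
    then have "inv x \<circ> y = id" using B_length_eq_0[of "inv x \<circ> y" N] xy by simp
    then have "x \<circ> (inv x \<circ> y) = x" by (simp only: comp_id)
    then show "x = y" using xy(1) by simp
  qed
qed

lemma id_absolute_order [simp]: "(id, x) \<in> absolute_order N \<longleftrightarrow> x \<in> hyperoctahedral N"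
  by (simp add: absolute_order_def B_le_def)

text \<open>Left translation by \<open>z\<close> identifies the interval below \<open>inv z \<circ> g\<close> with the interval
  from \<open>z\<close> to \<open>g\<close>, because lengths are additive along the order. Upper intervals are
  therefore intervals from the identity again.\<close>

lemma absolute_order_translate:
  assumes zg: "(z, g) \<in> absolute_order N"
  shows "(u, inv z \<circ> g) \<in> absolute_order N \<longleftrightarrow>
    u \<in> hyperoctahedral N \<and> (z, z \<circ> u) \<in> absolute_order N \<and> (z \<circ> u, g) \<in> absolute_order N"
proof (cases "u \<in> hyperoctahedral N")
  case u: True
  note z = absolute_orderD[OF zg]
  have eq: "inv (z \<circ> u) \<circ> g = inv u \<circ> (inv z \<circ> g)"
    using hyperoctahedral_inv_comp[OF z(1) u] by (simp only: comp_assoc)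
  have le1: "B_length N (z \<circ> u) \<le> B_length N z + B_length N u"
    using B_length_comp_le[OF z(1) u] .
  have "g = (z \<circ> u) \<circ> (inv u \<circ> (inv z \<circ> g))"
    unfolding comp_assoc using z(1) u by simp
  then have le2: "B_length N g \<le> B_length N (z \<circ> u) + B_length N (inv u \<circ> (inv z \<circ> g))"
    using B_length_comp_le[of "z \<circ> u" N "inv u \<circ> (inv z \<circ> g)"] z u by simp
  have "inv z \<circ> (z \<circ> u) = u" using z(1) by simp
  then show ?thesis
    using z u le1 le2 unfolding absolute_order_def B_le_def mem_Collect_eq prod.case eq by auto
next
  case False
  then show ?thesis by (auto simp: absolute_order_def)
qed

text \<open>The Kreweras complement \<open>y \<mapsto> inv y \<circ> g\<close> preserves the interval below \<open>g\<close>, since the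
  length is invariant under conjugation.\<close>

lemma absolute_order_complement:
  assumes "y \<in> hyperoctahedral N" "g \<in> hyperoctahedral N"
  shows "(inv y \<circ> g, g) \<in> absolute_order N \<longleftrightarrow> (y, g) \<in> absolute_order N"
proof -
  have "inv (inv y \<circ> g) \<circ> g = inv g \<circ> (y \<circ> g)"
    using hyperoctahedral_inv_comp[of "inv y" N g] assms by (simp add: comp_assoc)
  moreover have "B_length N (inv g \<circ> (y \<circ> g)) = B_length N y"
    using B_length_comp_commute[of "inv g" N "y \<circ> g"] assms by (simp add: comp_assoc)
  ultimately show ?thesis
    using assms by (auto simp: absolute_order_def B_le_def)
qed

definition group_moebius :: "nat \<Rightarrow> (int \<Rightarrow> int) \<Rightarrow> int" where
  "group_moebius N g = moebius (hyperoctahedral N) (absolute_order N) id g"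

lemma group_moebius_id [simp]: "group_moebius N id = 1"
  unfolding group_moebius_def
  by (subst moebius.simps) (simp add: finite_hyperoctahedral partial_order_absolute)

lemma sum_group_moebius_below:
  assumes g: "g \<in> hyperoctahedral N"
  shows "(\<Sum>x | (x, g) \<in> absolute_order N. group_moebius N x) = (if g = id then 1 else 0)"
proof -
  have fin: "finite {x. (x, g) \<in> absolute_order N}"
    by (rule finite_subset[OF _ finite_hyperoctahedral[of N]]) (auto simp: absolute_order_def)
  have gg: "(g, g) \<in> absolute_order N"
    using g by (simp add: absolute_order_def B_le_def)
  have below: "{z. (id, z) \<in> absolute_order N \<and> (z, g) \<in> absolute_order N \<and> z \<noteq> g}
      = {x. (x, g) \<in> absolute_order N} - {g}"
    using absolute_orderD(1) id_absolute_order by blast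
  have "(\<Sum>x | (x, g) \<in> absolute_order N. group_moebius N x)
      = group_moebius N g + (\<Sum>x \<in> {x. (x, g) \<in> absolute_order N} - {g}. group_moebius N x)"
    using gg fin by (subst sum.remove[of _ g]) auto
  moreover have "group_moebius N g = - (\<Sum>x \<in> {x. (x, g) \<in> absolute_order N} - {g}. group_moebius N x)"
    if "g \<noteq> id"
    unfolding group_moebius_def
    by (subst moebius.simps)
      (use g that below in \<open>simp add: finite_hyperoctahedral partial_order_absolute\<close>)
  moreover have "{x. (x, id) \<in> absolute_order N} - {id} = {}"
  proof -
    have "x = id" if "(x, id) \<in> absolute_order N" for x
      using absolute_orderD[OF that] B_length_eq_0[of x N] by simp
    then show ?thesis by blast
  qed
  ultimately show ?thesis by (cases "g = id") (simp_all only: group_moebius_id, simp_all)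
qed

text \<open>The Moebius function is defined by a recursion over lower intervals; the Kreweras
  complement turns it into the recursion over upper intervals. In
  \<open>group_moebius N (inv y \<circ> g)\<close> one should read the Moebius function of the interval
  from \<open>y\<close> to \<open>g\<close>.\<close>

lemma sum_group_moebius_complement:
  assumes g: "g \<in> hyperoctahedral N"
  shows "(\<Sum>y | (y, g) \<in> absolute_order N. group_moebius N (inv y \<circ> g)) = (if g = id then 1 else 0)"
proof -
  have "bij_betw (\<lambda>y. inv y \<circ> g) {y. (y, g) \<in> absolute_order N} {y. (y, g) \<in> absolute_order N}"
  proof (rule bij_betw_byWitness[where f' = "\<lambda>x. g \<circ> inv x"])
    have *: "g \<circ> inv (inv y \<circ> g) = y" "inv (g \<circ> inv y) \<circ> g = y" if "y \<in> hyperoctahedral N" for y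
      using that g hyperoctahedral_inv_comp[of "inv y" N g] hyperoctahedral_inv_comp[of g N "inv y"]
      by (simp_all add: comp_assoc)
    show "\<forall>y\<in>{y. (y, g) \<in> absolute_order N}. g \<circ> inv (inv y \<circ> g) = y"
      "\<forall>y\<in>{y. (y, g) \<in> absolute_order N}. inv (g \<circ> inv y) \<circ> g = y"
      using * absolute_orderD(1) by blast+
    show "(\<lambda>y. inv y \<circ> g) ` {y. (y, g) \<in> absolute_order N} \<subseteq> {y. (y, g) \<in> absolute_order N}"
      using absolute_order_complement[OF _ g] absolute_orderD(1) by blast
    show "(\<lambda>x. g \<circ> inv x) ` {y. (y, g) \<in> absolute_order N} \<subseteq> {y. (y, g) \<in> absolute_order N}"
    proof clarify
      fix x assume x: "(x, g) \<in> absolute_order N"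
      note xD = absolute_orderD[OF x]
      have "inv (g \<circ> inv x) \<circ> g = x" using *(2)[OF xD(1)] .
      then show "(g \<circ> inv x, g) \<in> absolute_order N"
        using absolute_order_complement[of "g \<circ> inv x" N g] x xD g by simp
    qed
  qed
  from sum.reindex_bij_betw[OF this, of "group_moebius N"] show ?thesis
    using sum_group_moebius_below[OF g] by simp
qed

lemma sum_group_moebius_between:
  assumes zg: "(z, g) \<in> absolute_order N"
  shows "(\<Sum>y | (z, y) \<in> absolute_order N \<and> (y, g) \<in> absolute_order N. group_moebius N (inv y \<circ> g))
    = (if g = z then 1 else 0)"
proof -
  note z = absolute_orderD[OF zg]
  let ?A = "{u. (u, inv z \<circ> g) \<in> absolute_order N}"
  let ?B = "{y. (z, y) \<in> absolute_order N \<and> (y, g) \<in> absolute_order N}"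
  have "bij_betw (\<lambda>u. z \<circ> u) ?A ?B"
  proof (rule bij_betw_byWitness[where f' = "\<lambda>y. inv z \<circ> y"])
    show "(\<lambda>y. inv z \<circ> y) ` ?B \<subseteq> ?A"
    proof clarify
      fix y assume y: "(z, y) \<in> absolute_order N" "(y, g) \<in> absolute_order N"
      then show "(inv z \<circ> y, inv z \<circ> g) \<in> absolute_order N"
        using z absolute_orderD(2)[OF y(1)] by (simp add: absolute_order_translate[OF zg])
    qed
    show "(\<lambda>u. z \<circ> u) ` ?A \<subseteq> ?B"
      using absolute_order_translate[OF zg] by blast
  qed (use z(1) in auto)
  from sum.reindex_bij_betw[OF this, of "\<lambda>y. group_moebius N (inv y \<circ> g)"]
  have "(\<Sum>y\<in>?B. group_moebius N (inv y \<circ> g)) = (\<Sum>u\<in>?A. group_moebius N (inv (z \<circ> u) \<circ> g))"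
    by simp
  also have "\<dots> = (\<Sum>u\<in>?A. group_moebius N (inv u \<circ> (inv z \<circ> g)))"
    using hyperoctahedral_inv_comp[OF z(1)] absolute_orderD(1)
    by (intro sum.cong) (auto simp: comp_assoc)
  also have "\<dots> = (if inv z \<circ> g = id then 1 else 0)"
    using z by (intro sum_group_moebius_complement) simp
  also have "inv z \<circ> g = id \<longleftrightarrow> g = z"
  proof
    assume "inv z \<circ> g = id"
    then have "z \<circ> (inv z \<circ> g) = z" by (simp only: comp_id)
    then show "g = z" using z(1) by simp
  qed (use z(1) in simp)
  finally show ?thesis .
qed

section \<open>Isolating a point and the Moebius recursion\<close>

text \<open>The first-return map of \<open>x\<close> off the points \<open>n\<close> and \<open>- n\<close>: these become fixed points
  and are cut out of their cycles. On partitions, \<open>\<plusminus>n\<close> become singletons.\<close>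

definition isolate :: "int \<Rightarrow> (int \<Rightarrow> int) \<Rightarrow> int \<Rightarrow> int" where
  "isolate n x = (if x n = n then x else reflection n (x n) \<circ> x)"

lemma isolate_hyperoctahedral [simp]:
  "x \<in> hyperoctahedral N \<Longrightarrow> n \<in> signed_points N \<Longrightarrow> isolate n x \<in> hyperoctahedral N"
  by (simp add: isolate_def hyperoctahedralD(3))

lemma isolate_fixes [simp]: "isolate n x n = n"
  by (simp add: isolate_def)

lemma B_length_isolate:
  assumes "x \<in> hyperoctahedral N" "n \<in> signed_points N" "x n \<noteq> n"
  shows "B_length N x = B_length N (isolate n x) + 1"
proof -
  have "3 ^ B_length N x * card (fixed_vectors N x)
      = 3 ^ B_length N (isolate n x) * card (fixed_vectors N (isolate n x))"
    using assms by (simp add: B_length_fixed_vectors)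
  also have "\<dots> = 3 ^ (B_length N (isolate n x) + 1) * card (fixed_vectors N x)"
    using card_fixed_vectors_isolate[OF assms] assms by (simp add: isolate_def)
  finally have "(3::nat) ^ B_length N x = 3 ^ (B_length N (isolate n x) + 1)"
    using card_fixed_vectors_pos[of N x] by (metis mult_right_cancel less_numeral_extra(3))
  then show ?thesis by (simp del: power_Suc add: power_inject_exp)
qed

lemma reflection_comp_le:
  assumes g: "g \<in> hyperoctahedral N" and ab: "a \<in> signed_points N" "b \<in> signed_points N" "a \<noteq> b"
  shows "(reflection a b, g) \<in> absolute_order N \<longleftrightarrow>
    B_length N g = B_length N (reflection a b \<circ> g) + 1"
proof -
  have "a \<noteq> 0" "b \<noteq> 0" using ab by (auto simp: signed_points_def)
  then show ?thesis
    using assms by (auto simp: absolute_order_def B_le_def B_length_reflection)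
qed

lemma reflection_conjugate:
  assumes y: "y \<in> hyperoctahedral N" and ab: "a \<in> signed_points N" "b \<in> signed_points N"
  shows "inv y \<circ> reflection a b = reflection (inv y a) (inv y b) \<circ> inv y"
proof
  fix k
  have iy: "inv y \<in> hyperoctahedral N" using y by simp
  have inj: "inv y i = inv y j \<longleftrightarrow> i = j" for i j
    using hyperoctahedralD(2)[OF iy] by (simp add: bij_is_inj inj_eq)
  have neg: "inv y (- i) = - inv y i" for i using hyperoctahedralD(1)[OF iy] .
  show "(inv y \<circ> reflection a b) k = (reflection (inv y a) (inv y b) \<circ> inv y) k"
    unfolding reflection_def comp_apply neg[symmetric] inj by (simp add: neg)
qed

lemma isolate_le:
  assumes x: "x \<in> hyperoctahedral N" and n: "n \<in> signed_points N"
  shows "(isolate n x, x) \<in> absolute_order N"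
proof (cases "x n = n")
  case True
  then show ?thesis using x by (simp add: isolate_def absolute_order_def B_le_def)
next
  case False
  have xn: "x n \<in> signed_points N" using hyperoctahedralD(3)[OF x] n by simp
  have "(reflection n (x n), x) \<in> absolute_order N"
    using False B_length_isolate[OF x n False] reflection_comp_le[OF x n xn] by (simp add: isolate_def)
  then have "(inv (reflection n (x n)) \<circ> x, x) \<in> absolute_order N"
    using absolute_order_complement[OF _ x] n xn by simp
  then show ?thesis
    using False n xn by (simp add: isolate_def signed_points_def)
qed

text \<open>Together with \<open>isolate_le\<close> this says that \<open>isolate n y\<close> is the largest element below
  \<open>y\<close> that fixes \<open>n\<close>. If \<open>z\<close> fixes \<open>n\<close>, conjugating the reflection used for \<open>y\<close> by \<open>z\<close>
  gives the reflection used for \<open>inv z \<circ> y\<close>, so isolating \<open>n\<close> commutes with translation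
  by \<open>z\<close> and lowers the lengths of \<open>y\<close> and \<open>inv z \<circ> y\<close> alike.\<close>

lemma le_isolate:
  assumes zy: "(z, y) \<in> absolute_order N" and n: "n \<in> signed_points N" and zn: "z n = n"
  shows "(z, isolate n y) \<in> absolute_order N"
proof (cases "y n = n")
  case True
  then show ?thesis using zy by (simp add: isolate_def)
next
  case False
  note z = absolute_orderD[OF zy]
  let ?w = "inv z \<circ> y"
  have iz: "inv z n = n" using z(1) zn by (metis hyperoctahedral_cancel(6))
  have yn: "y n \<in> signed_points N" using hyperoctahedralD(3)[OF z(2)] n by simp
  have w: "?w \<in> hyperoctahedral N" using z by simp
  have wn: "?w n \<noteq> n"
  proof
    assume "?w n = n"
    then have "z (inv z (y n)) = z n" by simp
    then show False using z(1) zn False by simp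
  qed
  have "inv z \<circ> isolate n y = (inv z \<circ> reflection n (y n)) \<circ> y"
    using False by (simp add: isolate_def comp_assoc)
  also have "\<dots> = isolate n ?w"
    unfolding reflection_conjugate[OF z(1) n yn] iz comp_assoc using wn by (simp add: isolate_def)
  finally have "B_length N (inv z \<circ> isolate n y) + 1 = B_length N ?w"
    using B_length_isolate[OF w n wn] by (simp only:)
  then show ?thesis
    using z B_length_isolate[OF z(2) n False] n by (simp add: absolute_order_def B_le_def)
qed

lemma isolate_eq_id_iff:
  assumes y: "y \<in> hyperoctahedral N" and n: "n \<in> signed_points N"
  shows "isolate n y = id \<longleftrightarrow> y = id \<or> (\<exists>i\<in>signed_points N. i \<noteq> n \<and> y = reflection n i)"
proof
  assume iso: "isolate n y = id"
  show "y = id \<or> (\<exists>i\<in>signed_points N. i \<noteq> n \<and> y = reflection n i)"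
  proof (cases "y n = n")
    case True
    then show ?thesis using iso by (simp add: isolate_def)
  next
    case False
    have yn: "y n \<in> signed_points N" using hyperoctahedralD(3)[OF y] n by simp
    have "reflection n (y n) \<circ> (reflection n (y n) \<circ> y) = reflection n (y n)"
      using iso False by (simp only: isolate_def if_False comp_id)
    then have "y = reflection n (y n)"
      using n yn by (simp add: signed_points_def)
    then show ?thesis using yn False by blast
  qed
next
  assume "y = id \<or> (\<exists>i\<in>signed_points N. i \<noteq> n \<and> y = reflection n i)"
  then show "isolate n y = id"
    using n by (auto simp: isolate_def signed_points_def)
qed

text \<open>Crapo's closure theorem for the interior operator \<open>isolate n\<close>. Grouping the sum over
  the interval from \<open>z\<close> to \<open>g\<close>, which is zero, by the value of the operator leaves the
  claimed sum and those for the values strictly above \<open>z\<close>; all values fix \<open>n\<close>, hence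
  differ from \<open>g\<close>, and the induction is on the distance to \<open>g\<close>.\<close>

lemma sum_group_moebius_isolate:
  assumes g: "g \<in> hyperoctahedral N" and n: "n \<in> signed_points N" "g n \<noteq> n"
    and z: "(z, g) \<in> absolute_order N" "z n = n"
  shows "(\<Sum>y | (y, g) \<in> absolute_order N \<and> isolate n y = z. group_moebius N (inv y \<circ> g)) = 0"
  using z
proof (induction "B_length N g - B_length N z" arbitrary: z rule: less_induct)
  case less
  let ?F = "\<lambda>z. \<Sum>y | (y, g) \<in> absolute_order N \<and> isolate n y = z. group_moebius N (inv y \<circ> g)"
  let ?B = "{y. (z, y) \<in> absolute_order N \<and> (y, g) \<in> absolute_order N}"
  have fin: "finite ?B"
    by (rule finite_subset[OF _ finite_hyperoctahedral[of N]]) (auto simp: absolute_order_def)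
  have iso_g: "(isolate n y, g) \<in> absolute_order N" if "(y, g) \<in> absolute_order N" for y
    using absolute_order_trans[OF isolate_le[OF absolute_orderD(1)[OF that] n(1)] that] .
  \<comment> \<open>Summation over a fibre within the interval is summation over the whole fibre:
    whatever is sent above \<open>z\<close> lies above \<open>z\<close>.\<close>
  have B_eq: "{y \<in> ?B. isolate n y = w} = {y. (y, g) \<in> absolute_order N \<and> isolate n y = w}"
    if "w \<in> isolate n ` ?B" for w
  proof -
    from that obtain y0 where "(z, y0) \<in> absolute_order N" "w = isolate n y0" by blast
    then have zw: "(z, w) \<in> absolute_order N" using le_isolate n(1) less.prems(2) by blast
    have "(z, y) \<in> absolute_order N" if "(y, g) \<in> absolute_order N" "isolate n y = w" for y
      using absolute_order_trans[OF zw] isolate_le[OF absolute_orderD(1)[OF that(1)] n(1)] that(2) by blast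
    then show ?thesis by blast
  qed
  have zB: "z \<in> isolate n ` ?B"
  proof (rule image_eqI)
    show "z = isolate n z" using less.prems(2) by (simp add: isolate_def)
    show "z \<in> ?B" using less.prems(1) absolute_orderD(1)[OF less.prems(1)]
      by (auto simp: absolute_order_def B_le_def)
  qed
  have other: "?F w = 0" if w: "w \<in> isolate n ` ?B" "w \<noteq> z" for w
  proof -
    obtain y where y: "(z, y) \<in> absolute_order N" "(y, g) \<in> absolute_order N" "w = isolate n y"
      using w(1) by blast
    have zw: "(z, w) \<in> absolute_order N" using y le_isolate n(1) less.prems(2) by blast
    have wg: "(w, g) \<in> absolute_order N" using iso_g y by simp
    have "B_length N w \<noteq> B_length N z"
    proof
      assume "B_length N w = B_length N z"
      then have "B_length N (inv z \<circ> w) = 0" using absolute_orderD(3)[OF zw] by simp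
      then have "inv z \<circ> w = id"
        using B_length_eq_0[of "inv z \<circ> w" N] absolute_orderD(1,2)[OF zw] by simp
      then have "z \<circ> (inv z \<circ> w) = z" by (simp only: comp_id)
      then show False using absolute_orderD(1)[OF zw] w(2) by simp
    qed
    then have "B_length N g - B_length N w < B_length N g - B_length N z"
      using absolute_orderD(3)[OF zw] absolute_orderD(3)[OF wg] by linarith
    then show ?thesis using less.hyps wg y(3) by simp
  qed
  have "0 = (\<Sum>y\<in>?B. group_moebius N (inv y \<circ> g))"
    using sum_group_moebius_between[OF less.prems(1)] less.prems(2) n(2) by auto
  also have "\<dots> = (\<Sum>w\<in>isolate n ` ?B. \<Sum>y | y \<in> ?B \<and> isolate n y = w. group_moebius N (inv y \<circ> g))"
    by (rule sum.image_gen[OF fin])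
  also have "\<dots> = (\<Sum>w\<in>isolate n ` ?B. ?F w)"
    by (intro sum.cong refl) (use B_eq in \<open>simp only:\<close>)
  also have "\<dots> = ?F z + (\<Sum>w\<in>isolate n ` ?B - {z}. ?F w)"
    using zB fin by (intro sum.remove) auto
  also have "(\<Sum>w\<in>isolate n ` ?B - {z}. ?F w) = 0"
    by (intro sum.neutral) (use other in blast)
  finally show ?case unfolding add_0_right by (rule sym)
qed

text \<open>The case \<open>z = id\<close> of the previous lemma: only the identity and the reflections moving
  \<open>n\<close> become trivial when \<open>n\<close> is isolated.\<close>

lemma group_moebius_recursion:
  assumes g: "g \<in> hyperoctahedral N" and n: "n \<in> signed_points N" "g n \<noteq> n"
  shows "group_moebius N g = - (\<Sum>i | i \<in> signed_points N \<and> i \<noteq> n \<and>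
      (reflection n i, g) \<in> absolute_order N. group_moebius N (reflection n i \<circ> g))"
proof -
  let ?I = "{i \<in> signed_points N. i \<noteq> n \<and> (reflection n i, g) \<in> absolute_order N}"
  have inj: "inj_on (reflection n) ?I"
    by (rule inj_onI) (metis reflection_simps(1))
  have set_eq: "{y. (y, g) \<in> absolute_order N \<and> isolate n y = id} = insert id (reflection n ` ?I)"
  proof (intro equalityI subsetI)
    fix y assume "y \<in> {y. (y, g) \<in> absolute_order N \<and> isolate n y = id}"
    then show "y \<in> insert id (reflection n ` ?I)"
      using isolate_eq_id_iff[OF absolute_orderD(1) n(1)] by blast
  next
    fix y assume "y \<in> insert id (reflection n ` ?I)"
    then show "y \<in> {y. (y, g) \<in> absolute_order N \<and> isolate n y = id}"
      using isolate_eq_id_iff[of y N n] g n(1) by auto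
  qed
  have nid: "id \<notin> reflection n ` ?I"
    by (auto simp: fun_eq_iff) (metis reflection_simps(1))
  have fin: "finite ?I" using finite_signed_points[of N] by simp
  have "0 = (\<Sum>y \<in> insert id (reflection n ` ?I). group_moebius N (inv y \<circ> g))"
    using sum_group_moebius_isolate[OF g n, of id] g unfolding set_eq[symmetric] by simp
  also have "\<dots> = group_moebius N g + (\<Sum>y \<in> reflection n ` ?I. group_moebius N (inv y \<circ> g))"
    using nid fin by (subst sum.insert) auto
  also have "(\<Sum>y \<in> reflection n ` ?I. group_moebius N (inv y \<circ> g))
      = (\<Sum>i\<in>?I. group_moebius N (inv (reflection n i) \<circ> g))"
    using sum.reindex[OF inj] by simp
  also have "\<dots> = (\<Sum>i\<in>?I. group_moebius N (reflection n i \<circ> g))"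
    using n by (intro sum.cong) (auto simp: signed_points_def)
  finally show ?thesis by (simp add: conj_ac)
qed

section \<open>The absolute order and inclusion of fixed spaces\<close>

text \<open>The dimension formula for a sum of two subspaces; the set of differences is the sum.\<close>

lemma card_diff_set:
  fixes U T :: "'a::ab_group_add set"
  assumes "finite U" "finite T"
    and "\<And>x y. x \<in> U \<Longrightarrow> y \<in> U \<Longrightarrow> x - y \<in> U" "\<And>x y. x \<in> T \<Longrightarrow> y \<in> T \<Longrightarrow> x - y \<in> T"
  shows "card U * card T = card (U \<inter> T) * card ((\<lambda>(x, y). x - y) ` (U \<times> T))"
proof -
  let ?h = "\<lambda>(x::'a, y). x - y"
  have "card (U \<times> T) = card {p \<in> U \<times> T. ?h p = 0} * card (?h ` (U \<times> T))"
    by (rule card_additive) (use assms in \<open>auto simp: algebra_simps\<close>)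
  moreover have "card {p \<in> U \<times> T. ?h p = 0} = card (U \<inter> T)"
    by (rule bij_betw_same_card[of fst], rule bij_betw_byWitness[where f' = "\<lambda>x. (x, x)"]) auto
  ultimately show ?thesis by (simp add: card_cartesian_product)
qed

lemma card_le_mult_Int:
  fixes U T V :: "'a::ab_group_add set"
  assumes "finite V" "U \<subseteq> V" "T \<subseteq> V" "\<And>x y. x \<in> V \<Longrightarrow> y \<in> V \<Longrightarrow> x - y \<in> V"
    and "\<And>x y. x \<in> U \<Longrightarrow> y \<in> U \<Longrightarrow> x - y \<in> U" "\<And>x y. x \<in> T \<Longrightarrow> y \<in> T \<Longrightarrow> x - y \<in> T"
  shows "card U * card T \<le> card (U \<inter> T) * card V"
proof -
  have "(\<lambda>(x, y). x - y) ` (U \<times> T) \<subseteq> V" using assms(2-4) by auto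
  then have "card ((\<lambda>(x, y). x - y) ` (U \<times> T)) \<le> card V"
    using assms(1) card_mono by blast
  moreover have "card U * card T = card (U \<inter> T) * card ((\<lambda>(x, y). x - y) ` (U \<times> T))"
    using assms finite_subset[OF _ assms(1)] by (intro card_diff_set) auto
  ultimately show ?thesis by simp
qed

text \<open>If \<open>y = x \<circ> w\<close>, vectors fixed by \<open>x\<close> and by \<open>w\<close> are fixed by \<open>y\<close>. When the lengths add
  up, the dimension formula leaves no room for further vectors fixed by \<open>y\<close>.\<close>

lemma fixed_vectors_absolute_order:
  assumes xy: "(x, y) \<in> absolute_order N"
  shows "fixed_vectors N y \<subseteq> fixed_vectors N x"
proof -
  note D = absolute_orderD[OF xy]
  let ?w = "inv x \<circ> y" and ?V = "odd_vectors N"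
  let ?I = "fixed_vectors N x \<inter> fixed_vectors N ?w"
  have w: "?w \<in> hyperoctahedral N" using D by simp
  have "?I \<subseteq> fixed_vectors N y"
  proof clarify
    fix v assume v: "v \<in> fixed_vectors N x" "v \<in> fixed_vectors N ?w"
    have "v (y i) = v i" for i
    proof -
      have "v (x (?w i)) = v (?w i)" using v(1) by (rule fixed_vectorsD)
      also have "\<dots> = v i" using v(2) by (rule fixed_vectorsD)
      finally show ?thesis using D(1) by simp
    qed
    then show "v \<in> fixed_vectors N y"
      using v(1) by (simp add: fixed_vectors_def fun_eq_iff)
  qed
  moreover have "card (fixed_vectors N y) \<le> card ?I"
  proof -
    have "card (fixed_vectors N x) * card (fixed_vectors N ?w) \<le> card ?I * card ?V"
      by (rule card_le_mult_Int) (auto simp: finite_odd_vectors fixed_vectorsD)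
    then have "3 ^ B_length N y * (card (fixed_vectors N x) * card (fixed_vectors N ?w))
        \<le> 3 ^ B_length N y * (card ?I * card ?V)"
      by (intro mult_left_mono) auto
    also have "3 ^ B_length N y * (card (fixed_vectors N x) * card (fixed_vectors N ?w)) =
      (3 ^ B_length N x * card (fixed_vectors N x)) * (3 ^ B_length N ?w * card (fixed_vectors N ?w))"
      unfolding D(3) power_add by (simp only: mult_ac)
    also have "\<dots> = card ?V * card ?V"
      unfolding B_length_fixed_vectors[OF D(1)] B_length_fixed_vectors[OF w] ..
    also have "\<dots> = card ?V * (3 ^ B_length N y * card (fixed_vectors N y))"
      unfolding B_length_fixed_vectors[OF D(2)] ..
    finally have "(3 ^ B_length N y * card ?V) * card (fixed_vectors N y)
        \<le> (3 ^ B_length N y * card ?V) * card ?I"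
      by (simp only: mult_ac)
    moreover have "3 ^ B_length N y * card ?V > 0"
      using card_fixed_vectors_pos[of N id] by simp
    ultimately show ?thesis by (meson mult_le_cancel1)
  qed
  ultimately have "?I = fixed_vectors N y"
    by (intro card_seteq) auto
  then show ?thesis by blast
qed

section \<open>Cycles as lists and the reflections below a signed permutation\<close>

text \<open>A cycle of \<open>g\<close> is the case \<open>e = hd xs\<close>; the case \<open>e = - hd xs\<close> describes a
  self-opposite cycle, of which \<open>xs\<close> is one half. Leaving the endpoint \<open>e\<close> free makes
  the notion stable under cutting a list in two, which is how reflections act on cycles.\<close>

definition traces :: "(int \<Rightarrow> int) \<Rightarrow> int list \<Rightarrow> int \<Rightarrow> bool" where
  "traces g xs e \<longleftrightarrow> xs \<noteq> [] \<and> map g xs = tl xs @ [e]"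

lemma traces_append:
  assumes "us \<noteq> []" "vs \<noteq> []"
  shows "traces g (us @ vs) e \<longleftrightarrow> traces g us (hd vs) \<and> traces g vs e"
proof -
  have eq: "tl (us @ vs) @ [e] = (tl us @ [hd vs]) @ (tl vs @ [e])"
    using assms by (cases vs) auto
  have len: "length (map g us) = length (tl us @ [hd vs])"
    using assms by (cases us) auto
  have "map g (us @ vs) = tl (us @ vs) @ [e] \<longleftrightarrow> map g us = tl us @ [hd vs] \<and> map g vs = tl vs @ [e]"
    unfolding eq map_append using len by (intro append_eq_append_conv) blast
  then show ?thesis using assms unfolding traces_def by simp
qed

lemma traces_comp:
  assumes "traces g xs e" "\<And>k. k \<in> set (tl xs) \<Longrightarrow> t k = k"
  shows "traces (t \<circ> g) xs (t e)"
proof -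
  have "map (t \<circ> g) xs = map t (tl xs @ [e])"
    using assms(1) unfolding traces_def map_map[symmetric] by simp
  also have "\<dots> = tl xs @ [t e]"
    using assms(2) by (simp add: map_idI)
  finally show ?thesis using assms(1) by (simp add: traces_def)
qed

lemma traces_uminus:
  assumes "g \<in> hyperoctahedral N" "traces g xs e"
  shows "traces g (map uminus xs) (- e)"
proof -
  have "map g (map uminus xs) = map uminus (map g xs)"
    using hyperoctahedralD(1)[OF assms(1)] by (simp add: comp_def)
  also have "\<dots> = tl (map uminus xs) @ [- e]"
    using assms(2) by (simp add: traces_def map_tl)
  finally show ?thesis using assms(2) by (simp add: traces_def)
qed

lemma traces_last: "traces g xs e \<Longrightarrow> g (last xs) = e"
  unfolding traces_def by (metis last_map last_snoc)

lemma traces_image: "traces g xs e \<Longrightarrow> g ` set xs = insert e (set (tl xs))"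
  unfolding traces_def by (metis Un_insert_right list.set_map list.simps(15) set_append sup_bot_right empty_set)

lemma fixed_vector_traces:
  assumes "v \<in> fixed_vectors N g" "traces g xs e"
  shows "\<forall>k\<in>set xs. v k = v e"
  using assms(2)
proof (induction xs)
  case (Cons x ys)
  show ?case
  proof (cases "ys = []")
    case True
    then show ?thesis using Cons.prems fixed_vectorsD(2)[OF assms(1), of x] by (auto simp: traces_def)
  next
    case False
    then have "traces g ys e" "traces g [x] (hd ys)"
      using Cons.prems traces_append[of "[x]" ys g e] by auto
    moreover have "hd ys \<in> set ys" using False by simp
    ultimately show ?thesis
      using Cons.IH fixed_vectorsD(2)[OF assms(1), of x] by (auto simp: traces_def)
  qed
qed (simp add: traces_def)

lemma distinct_abs_uminus:
  assumes "distinct (map abs xs)" "set xs \<subseteq> signed_points N" "i \<in> set xs"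
  shows "- i \<notin> set xs"
proof
  assume "- i \<in> set xs"
  then have "- i = i"
    using assms(1,3) by (metis abs_minus_cancel distinct_map inj_onD)
  then show False using assms(2,3) signed_points_neq(1) by (metis subsetD)
qed

text \<open>If the fixed vectors of \<open>g\<close> lie in the hyperplane of the reflection, they stay fixed
  after composing with it. To see that the length drops it then suffices to exhibit one
  new fixed vector, here the indicator of a cycle of the product that \<open>g\<close> does not
  preserve.\<close>

lemma reflection_le_by_cycle:
  assumes g: "g \<in> hyperoctahedral N" and ni: "n \<in> signed_points N" "i \<in> signed_points N" "n \<noteq> i"
    and fixed: "\<And>v. v \<in> fixed_vectors N g \<Longrightarrow> v n = v i"
    and xs: "traces (reflection n i \<circ> g) xs (hd xs)" "distinct (map abs xs)" "set xs \<subseteq> signed_points N"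
    and out: "g (last xs) \<notin> set xs"
  shows "(reflection n i, g) \<in> absolute_order N"
proof -
  let ?t = "reflection n i" and ?v = "odd_indicator (set xs)"
  have tg: "?t \<circ> g \<in> hyperoctahedral N" using g ni by simp
  have ne: "xs \<noteq> []" using xs(1) by (simp add: traces_def)
  have "(?t \<circ> g) ` set xs \<subseteq> set xs"
    unfolding traces_image[OF xs(1)] using ne by (cases xs) auto
  then have v: "?v \<in> fixed_vectors N (?t \<circ> g)"
    using distinct_abs_uminus[OF xs(2,3)] xs(3) by (intro odd_indicator_fixed[OF tg]) auto
  have "?v \<notin> fixed_vectors N g"
  proof
    assume "?v \<in> fixed_vectors N g"
    then have "?v (g (last xs)) = ?v (last xs)" by (rule fixed_vectorsD)
    then show False using out ne by (simp add: odd_indicator_def split: if_splits)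
  qed
  moreover have "fixed_vectors N g \<subseteq> fixed_vectors N (?t \<circ> g)"
    using fixed_vectors_reflection_comp[of N g n i] fixed by blast
  ultimately have "card (fixed_vectors N g) < card (fixed_vectors N (?t \<circ> g))"
    using v by (intro psubset_card_mono) auto
  then have "B_length N (?t \<circ> g) < B_length N g"
    using B_length_le_iff[OF g tg] by simp
  moreover have "B_length N g \<le> B_length N ?t + B_length N (?t \<circ> g)"
    using B_length_comp_le[of ?t N "?t \<circ> g"] ni tg by (simp add: signed_points_def)
  ultimately show ?thesis
    using reflection_comp_le[OF g ni] B_length_reflection[OF ni] by simp
qed

text \<open>The converse test: any fixed vector of \<open>g\<close> that separates \<open>n\<close> from \<open>i\<close> excludes the
  reflection.\<close>

lemma reflection_le_fixed:
  assumes "(reflection n i, g) \<in> absolute_order N" "v \<in> fixed_vectors N g"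
  shows "v n = v i"
  using fixed_vectors_absolute_order[OF assms(1)] assms(2) fixed_vectorsD(2)[of v N "reflection n i" n]
  by auto

text \<open>The list \<open>zs\<close> is one half of the only self-opposite cycle (empty if there is none) and
  each list in \<open>xss\<close> represents a pair of opposite cycles. Fixed points may be listed as
  cycles of length one or left out; the value \<open>moebius_A 1 = 1\<close> makes both descriptions
  agree.\<close>

definition signed_cycles :: "nat \<Rightarrow> (int \<Rightarrow> int) \<Rightarrow> int list \<Rightarrow> int list list \<Rightarrow> bool" where
  "signed_cycles N g zs xss \<longleftrightarrow> g \<in> hyperoctahedral N \<and>
     distinct (map abs (zs @ concat xss)) \<and> set (zs @ concat xss) \<subseteq> signed_points N \<and>
     (zs \<noteq> [] \<longrightarrow> traces g zs (- hd zs)) \<and> (\<forall>xs\<in>set xss. traces g xs (hd xs)) \<and>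
     (\<forall>k. \<bar>k\<bar> \<notin> abs ` set (zs @ concat xss) \<longrightarrow> g k = k)"

lemma traces_reflection_disjoint:
  assumes "traces g xs e" "\<And>k. k \<in> insert e (set xs) \<Longrightarrow> \<bar>k\<bar> \<noteq> \<bar>a\<bar> \<and> \<bar>k\<bar> \<noteq> \<bar>b\<bar>"
  shows "traces (reflection a b \<circ> g) xs e"
proof -
  have "traces (reflection a b \<circ> g) xs (reflection a b e)"
    using assms(2) list.set_sel(2)[of xs] assms(1)
    by (intro traces_comp[OF assms(1)] reflection_other) (auto simp: traces_def)
  then show ?thesis using assms(2)[of e] by (simp add: reflection_other)
qed

section \<open>Signed Catalan numbers and central binomial coefficients\<close>

text \<open>For \<open>k \<ge> 1\<close> this is the Catalan number with index \<open>k - 1\<close>, up to sign: the Moebius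
  number of the non-crossing partitions of a \<open>k\<close>-element set.\<close>

definition moebius_A :: "nat \<Rightarrow> real" where
  "moebius_A k = (- 1) ^ (k - 1) * real ((2 * (k - 1)) choose (k - 1)) / real k"

text \<open>The Moebius number of the non-crossing partitions of type B. The value at \<open>0\<close> is not
  half a binomial coefficient but the empty product, for permutations without a
  self-opposite cycle.\<close>

definition moebius_B :: "nat \<Rightarrow> real" where
  "moebius_B k = (if k = 0 then 1 else (- 1) ^ k * real ((2 * k) choose k) / 2)"

lemma moebius_A_1 [simp]: "moebius_A (Suc 0) = 1"
  by (simp add: moebius_A_def)

text \<open>Rewriting the numbers as coefficients of \<open>(1 + 4 z)\<close> to the powers \<open>\<plusminus>1/2\<close> makes their
  convolutions instances of Vandermonde's identity.\<close>

lemma central_binomial_gbinomial: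
  "4 ^ k * ((- 1 / 2 :: real) gchoose k) = (- 1) ^ k * real ((2 * k) choose k)"
proof (induction k)
  case (Suc k)
  have g: "real (Suc k) * ((- 1 / 2 :: real) gchoose Suc k) = (- 1 / 2 - real k) * ((- 1 / 2) gchoose k)"
    using gbinomial_mult_1[of "- 1 / 2 :: real" k] by (simp add: algebra_simps)
  have "real (Suc k) * real ((2 * Suc k) choose Suc k) = 2 * (2 * real k + 1) * real ((2 * k) choose k)"
  proof -
    have 1: "Suc k * ((2 * k + 2) choose Suc k) = (2 * k + 2) * ((2 * k + 1) choose k)"
      using binomial_absorption[of k "2 * k + 2"] by simp
    have "(2 * k + 1) choose k = (2 * k + 1) choose Suc k"
      using binomial_symmetric[of k "2 * k + 1"] by simp
    moreover have 2: "Suc k * ((2 * k + 1) choose Suc k) = (2 * k + 1) * ((2 * k) choose k)"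
      using binomial_absorption[of k "2 * k + 1"] by simp
    ultimately have "Suc k * (Suc k * ((2 * k + 2) choose Suc k)) = Suc k * (2 * ((2 * k + 1) * ((2 * k) choose k)))"
      unfolding 1 2[symmetric] by (simp only:) (simp add: algebra_simps)
    then have "Suc k * ((2 * k + 2) choose Suc k) = 2 * ((2 * k + 1) * ((2 * k) choose k))"
      by (metis Suc_mult_cancel1)
    then have "real (Suc k * ((2 * k + 2) choose Suc k)) = real (2 * ((2 * k + 1) * ((2 * k) choose k)))"
      by (rule arg_cong)
    then show ?thesis unfolding of_nat_mult by (simp add: algebra_simps)
  qed
  note c = this
  have "real (Suc k) * ((- 1) ^ Suc k * real ((2 * Suc k) choose Suc k))
      = (- 1) ^ Suc k * (real (Suc k) * real ((2 * Suc k) choose Suc k))"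
    by (rule mult.left_commute)
  also have "\<dots> = - 2 * (2 * real k + 1) * ((- 1) ^ k * real ((2 * k) choose k))"
    unfolding c by (simp add: algebra_simps)
  also have "\<dots> = - 2 * (2 * real k + 1) * (4 ^ k * ((- 1 / 2) gchoose k))"
    using Suc.IH by simp
  also have "\<dots> = 4 ^ Suc k * ((- 1 / 2 - real k) * ((- 1 / 2) gchoose k))"
    by (simp add: algebra_simps)
  also have "\<dots> = real (Suc k) * (4 ^ Suc k * ((- 1 / 2) gchoose Suc k))"
    unfolding g[symmetric] by (simp only: mult.left_commute)
  finally show ?case by (metis mult_cancel_left of_nat_eq_0_iff nat.distinct(1))
qed simp

lemma moebius_A_gbinomial: "4 ^ Suc k * ((1 / 2 :: real) gchoose Suc k) = 2 * moebius_A (Suc k)"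
proof -
  have "(1 / 2 :: real) gchoose Suc k = (1 / 2) / real (Suc k) * ((- 1 / 2) gchoose k)"
    using gbinomial_absorption'[of "Suc k" "1 / 2 :: real"] by simp
  then have "4 ^ Suc k * ((1 / 2 :: real) gchoose Suc k) = 2 * (4 ^ k * ((- 1 / 2 :: real) gchoose k)) / real (Suc k)"
    by (simp only:) (simp add: divide_simps)
  then show ?thesis by (simp only: central_binomial_gbinomial) (simp add: moebius_A_def)
qed

lemma moebius_B_gbinomial: "4 ^ Suc k * ((- 1 / 2 :: real) gchoose Suc k) = 2 * moebius_B (Suc k)"
  unfolding central_binomial_gbinomial by (simp add: moebius_B_def)

text \<open>Vandermonde's identity with the two end terms, where one of the factors is \<open>1\<close>, split
  off.\<close>

lemma gbinomial_convolution_0: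
  assumes "(a + b :: real) gchoose Suc L = 0"
  shows "4 ^ Suc L * (a gchoose Suc L) + 4 ^ Suc L * (b gchoose Suc L)
    + (\<Sum>k<L. (4 ^ Suc k * (a gchoose Suc k)) * (4 ^ (L - k) * (b gchoose (L - k)))) = 0"
proof -
  let ?f = "\<lambda>k. (4 ^ k * (a gchoose k)) * (4 ^ (Suc L - k) * (b gchoose (Suc L - k)))"
  have "(\<Sum>k\<le>Suc L. ?f k) = 4 ^ Suc L * (\<Sum>k\<le>Suc L. (a gchoose k) * (b gchoose (Suc L - k)))"
    unfolding sum_distrib_left
    by (intro sum.cong refl) (simp add: power_add[symmetric] mult_ac del: power_Suc)
  also have "\<dots> = 0"
    using gbinomial_Vandermonde[of a b "Suc L"] assms by (simp add: atLeast0AtMost)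
  also have "(\<Sum>k\<le>Suc L. ?f k) = ?f 0 + (\<Sum>k\<le>L. ?f (Suc k))"
    by (rule sum.atMost_Suc_shift)
  also have "(\<Sum>k\<le>L. ?f (Suc k)) = (\<Sum>k<L. ?f (Suc k)) + ?f (Suc L)"
    by (simp only: lessThan_Suc_atMost[symmetric] sum.lessThan_Suc)
  finally show ?thesis by (simp add: algebra_simps)
qed

text \<open>The square of \<open>\<surd>(1 + 4 z)\<close> has no coefficient beyond the linear one.\<close>

lemma moebius_A_recursion:
  assumes "L \<ge> 1"
  shows "moebius_A (Suc L) = - (\<Sum>k<L. moebius_A (Suc k) * moebius_A (L - k))"
proof -
  have *: "4 ^ (L - k) * ((1 / 2 :: real) gchoose (L - k)) = 2 * moebius_A (L - k)" if "k < L" for k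
    using moebius_A_gbinomial[of "L - k - 1"] that by (simp add: Suc_diff_Suc del: power_Suc)
  have "(1 / 2 + 1 / 2 :: real) gchoose Suc L = 0"
    using assms binomial_gbinomial[of 1 "Suc L", where 'a = real] by (simp add: binomial_eq_0)
  from gbinomial_convolution_0[OF this]
  have "4 * moebius_A (Suc L) + (\<Sum>k<L. (2 * moebius_A (Suc k)) * (2 * moebius_A (L - k))) = 0"
    unfolding moebius_A_gbinomial using * by (simp cong: sum.cong_simp)
  also have "(\<Sum>k<L. (2 * moebius_A (Suc k)) * (2 * moebius_A (L - k)))
      = 4 * (\<Sum>k<L. moebius_A (Suc k) * moebius_A (L - k))"
    unfolding sum_distrib_left by (intro sum.cong) auto
  finally show ?thesis by simp
qed

text \<open>The product of \<open>\<surd>(1 + 4 z)\<close> with its reciprocal is constant.\<close>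

lemma moebius_B_recursion:
  "moebius_B (Suc L) = - (moebius_A (Suc L) + (\<Sum>k<L. moebius_A (Suc k) * moebius_B (L - k))
    + (\<Sum>k<L. moebius_B (Suc k) * moebius_A (L - k)))"
proof -
  have *: "4 ^ (L - k) * ((- 1 / 2 :: real) gchoose (L - k)) = 2 * moebius_B (L - k)" if "k < L" for k
    using moebius_B_gbinomial[of "L - k - 1"] that by (simp add: Suc_diff_Suc del: power_Suc)
  have "(1 / 2 + - 1 / 2 :: real) gchoose Suc L = 0" by simp
  from gbinomial_convolution_0[OF this]
  have "2 * moebius_A (Suc L) + 2 * moebius_B (Suc L)
      + (\<Sum>k<L. (2 * moebius_A (Suc k)) * (2 * moebius_B (L - k))) = 0"
    unfolding moebius_A_gbinomial moebius_B_gbinomial using * by (simp cong: sum.cong_simp)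
  also have "(\<Sum>k<L. (2 * moebius_A (Suc k)) * (2 * moebius_B (L - k)))
      = 4 * (\<Sum>k<L. moebius_A (Suc k) * moebius_B (L - k))"
    unfolding sum_distrib_left by (intro sum.cong) auto
  finally have "moebius_B (Suc L) = - (moebius_A (Suc L) + 2 * (\<Sum>k<L. moebius_A (Suc k) * moebius_B (L - k)))"
    by simp
  moreover have "(\<Sum>k<L. moebius_B (Suc k) * moebius_A (L - k)) = (\<Sum>k<L. moebius_A (Suc k) * moebius_B (L - k))"
    by (subst sum.nat_diff_reindex[symmetric]) (intro sum.cong, auto simp: Suc_diff_Suc mult.commute)
  ultimately show ?thesis by simp
qed

lemma moebius_formula:
  assumes "n \<ge> 2"
  shows "- (moebius_B (n - 1) + 2 * real (n - 1) * moebius_A n)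
    = (- 1) ^ n * real ((2 * n - 1) choose n) * ((5 * real n - 4) / (4 * real n - 2))"
proof -
  obtain m where m: "n = Suc m" "m > 0" using assms by (cases n) auto
  have "Suc m * ((2 * m + 1) choose Suc m) = (2 * m + 1) * ((2 * m) choose m)"
    using binomial_absorption[of m "2 * m + 1"] by simp
  then have "real (Suc m * ((2 * m + 1) choose Suc m)) = real ((2 * m + 1) * ((2 * m) choose m))"
    by (rule arg_cong)
  then have c: "real ((2 * m + 1) choose Suc m) = (2 * real m + 1) * real ((2 * m) choose m) / (real m + 1)"
    unfolding of_nat_mult by (simp add: field_simps)
  have "2 * n - 1 = 2 * m + 1" using m by simp
  then have "(- 1) ^ n * real ((2 * n - 1) choose n) * ((5 * real n - 4) / (4 * real n - 2))
      = (- 1) ^ n * ((2 * real m + 1) * real ((2 * m) choose m) / (real m + 1)) * ((5 * real m + 1) / (2 * (2 * real m + 1)))"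
    unfolding c[symmetric] using m by (simp only:) (simp add: algebra_simps)
  also have "\<dots> = (- 1) ^ n * real ((2 * m) choose m) * ((5 * real m + 1) / (2 * (real m + 1)))"
    by (simp add: divide_simps) (simp add: algebra_simps)
  also have "\<dots> = - (moebius_B (n - 1) + 2 * real (n - 1) * moebius_A n)"
    using m by (simp add: moebius_A_def moebius_B_def divide_simps) (simp add: algebra_simps)
  finally show ?thesis by simp
qed

lemma signed_cyclesD:
  assumes "signed_cycles N g zs xss"
  shows "g \<in> hyperoctahedral N" "distinct (map abs (zs @ concat xss))"
    "set (zs @ concat xss) \<subseteq> signed_points N" "zs \<noteq> [] \<Longrightarrow> traces g zs (- hd zs)"
    "\<And>xs. xs \<in> set xss \<Longrightarrow> traces g xs (hd xs)"
    "\<And>k. \<bar>k\<bar> \<notin> abs ` set (zs @ concat xss) \<Longrightarrow> g k = k"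
  using assms unfolding signed_cycles_def by blast+

section \<open>The Moebius function of a permutation with at most one self-opposite cycle\<close>

text \<open>A reflection in points of \<open>zs\<close> and \<open>yss\<close> rearranges these lists and leaves the cycles
  in \<open>rest\<close> alone. Up to signs, the new lists contain the same points.\<close>

lemma signed_cycles_step:
  assumes sc: "signed_cycles N g zs xss" and xss: "xss = yss @ rest"
    and ab: "a \<in> signed_points N" "b \<in> signed_points N"
      "\<bar>a\<bar> \<in> abs ` set (zs @ concat yss)" "\<bar>b\<bar> \<in> abs ` set (zs @ concat yss)"
    and new: "mset (map abs (zs' @ concat yss')) = mset (map abs (zs @ concat yss))"
      "set (zs' @ concat yss') \<subseteq> signed_points N"
    and tr: "zs' \<noteq> [] \<Longrightarrow> traces (reflection a b \<circ> g) zs' (- hd zs')"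
      "\<And>xs. xs \<in> set yss' \<Longrightarrow> traces (reflection a b \<circ> g) xs (hd xs)"
  shows "signed_cycles N (reflection a b \<circ> g) zs' (yss' @ rest)"
proof -
  note D = signed_cyclesD[OF sc]
  let ?t = "reflection a b"
  have mset_eq: "mset (map abs (zs' @ concat (yss' @ rest))) = mset (map abs (zs @ concat xss))"
    using new(1) unfolding xss by simp
  then have set_eq: "abs ` set (zs' @ concat (yss' @ rest)) = abs ` set (zs @ concat xss)"
    by (metis mset_eq_setD list.set_map)
  have "distinct (map abs (zs' @ concat (yss' @ rest)))"
    using D(2) mset_eq mset_eq_imp_distinct_iff by blast
  moreover have "set (zs' @ concat (yss' @ rest)) \<subseteq> signed_points N"
    using new(2) D(3) unfolding xss by auto
  moreover have "traces (?t \<circ> g) xs (hd xs)" if xs: "xs \<in> set rest" for xs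
  proof (rule traces_reflection_disjoint)
    show tr: "traces g xs (hd xs)" using D(5) xs unfolding xss by simp
    have "distinct (map abs (zs @ concat yss) @ map abs (concat rest))"
      using D(2) unfolding xss by simp
    then have disj: "abs ` set (zs @ concat yss) \<inter> abs ` set (concat rest) = {}"
      unfolding distinct_append set_map by blast
    fix k assume "k \<in> insert (hd xs) (set xs)"
    then have "k \<in> set xs" using tr hd_in_set by (auto simp: traces_def)
    then have "k \<in> set (concat rest)" using xs by auto
    then have "\<bar>k\<bar> \<notin> abs ` set (zs @ concat yss)" using disj by blast
    then show "\<bar>k\<bar> \<noteq> \<bar>a\<bar> \<and> \<bar>k\<bar> \<noteq> \<bar>b\<bar>" using ab(3,4) by metis
  qed
  moreover have "(?t \<circ> g) k = k" if "\<bar>k\<bar> \<notin> abs ` set (zs @ concat xss)" for k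
  proof -
    have "abs ` set (zs @ concat yss) \<subseteq> abs ` set (zs @ concat xss)" unfolding xss by auto
    then have "\<bar>k\<bar> \<notin> abs ` set (zs @ concat yss)" using that by blast
    then have "\<bar>k\<bar> \<noteq> \<bar>a\<bar> \<and> \<bar>k\<bar> \<noteq> \<bar>b\<bar>" using ab(3,4) by metis
    then show ?thesis using D(6)[OF that] by (simp add: reflection_other)
  qed
  moreover have "?t \<circ> g \<in> hyperoctahedral N" using D(1) ab by simp
  ultimately show ?thesis
    using tr unfolding signed_cycles_def set_eq by auto
qed

lemma abs_notin_image: "a \<notin> abs ` A \<Longrightarrow> k \<in> A \<Longrightarrow> \<bar>k :: int\<bar> \<noteq> a"
  by blast

lemma split_at_nth:
  assumes "k < length ys"
  obtains us vs where "ys = us @ (ys ! k) # vs" "length us = k" "length vs = length ys - Suc k"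
  using id_take_nth_drop[OF assms] assms that[of "take k ys" "drop (Suc k) ys"] by simp

text \<open>The product sends the predecessor of \<open>i\<close> back to \<open>x\<close> and the predecessor of \<open>x\<close> to
  \<open>i\<close>, which splits the cycle. The indicator of the piece through \<open>x\<close> is the new fixed
  vector.\<close>

lemma paired_cycle_split:
  assumes sc: "signed_cycles N g zs ((x # us @ i # vs) # rest)"
  shows "(reflection x i, g) \<in> absolute_order N"
    "signed_cycles N (reflection x i \<circ> g) zs ((x # us) # (i # vs) # rest)"
proof -
  note D = signed_cyclesD[OF sc]
  let ?t = "reflection x i"
  have dist: "distinct (map abs (zs @ (x # us @ i # vs)))"
    using D(2) by (simp add: Int_Un_distrib)
  have pts: "x \<in> signed_points N" "i \<in> signed_points N" "set us \<subseteq> signed_points N"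
    "set vs \<subseteq> signed_points N" "set zs \<subseteq> signed_points N" using D(3) by auto
  have ne: "x \<noteq> i" using dist by auto
  have nz: "x \<noteq> 0" "i \<noteq> 0" using pts by (auto simp: signed_points_def)
  have notin: "\<bar>x\<bar> \<notin> abs ` (set us \<union> set vs \<union> set zs)" "\<bar>i\<bar> \<notin> abs ` (set us \<union> set vs \<union> set zs)"
    using dist by (simp_all add: image_Un Int_Un_distrib)
  have other: "?t k = k" if "k \<in> set us \<union> set vs \<union> set zs" for k
    using notin[THEN abs_notin_image, OF that] by (rule reflection_other)
  have "traces g ((x # us) @ (i # vs)) x" using D(5)[of "x # us @ i # vs"] by simp
  then have tr: "traces g (x # us) i" "traces g (i # vs) x"
    by (subst (asm) traces_append; simp)+
  have t1: "traces (?t \<circ> g) (x # us) x"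
    using traces_comp[OF tr(1), of ?t] other by simp
  have t2: "traces (?t \<circ> g) (i # vs) i"
    using traces_comp[OF tr(2), of ?t] other by simp
  have t3: "traces (?t \<circ> g) zs (- hd zs)" if "zs \<noteq> []"
  proof -
    have hd: "hd zs \<in> set zs" using that by simp
    have "\<bar>k\<bar> \<noteq> \<bar>x\<bar> \<and> \<bar>k\<bar> \<noteq> \<bar>i\<bar>" if k: "k \<in> insert (- hd zs) (set zs)" for k
    proof -
      have "\<bar>k\<bar> \<in> abs ` set zs" using k hd by force
      then show ?thesis using notin by (metis UnI2 image_Un)
    qed
    then show ?thesis
      by (rule traces_reflection_disjoint[OF D(4)[OF that]])
  qed
  have t4: "traces (?t \<circ> g) xs (hd xs)" if "xs \<in> set [x # us, i # vs]" for xs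
    using that t1 t2 by auto
  show "signed_cycles N (?t \<circ> g) zs ((x # us) # (i # vs) # rest)"
    using signed_cycles_step[OF sc, of "[x # us @ i # vs]" rest x i zs "[x # us, i # vs]"]
      pts t3 t4 by simp
  show "(?t, g) \<in> absolute_order N"
  proof (rule reflection_le_by_cycle[OF D(1) pts(1,2) ne])
    show "v x = v i" if "v \<in> fixed_vectors N g" for v
      using fixed_vector_traces[OF that tr(1)] by simp
    show "traces (?t \<circ> g) (x # us) (hd (x # us))" using t1 by simp
    show "g (last (x # us)) \<notin> set (x # us)"
      using traces_last[OF tr(1)] dist by auto
  qed (use dist pts in auto)
qed

text \<open>No other reflection moving \<open>x\<close> is below \<open>g\<close>, because the indicator of the cycle is a
  fixed vector that separates \<open>x\<close> from all points outside.\<close>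

lemma below_paired_cycle:
  assumes sc: "signed_cycles N g zs ((x # ys) # rest)"
  shows "{i. i \<in> signed_points N \<and> i \<noteq> x \<and> (reflection x i, g) \<in> absolute_order N} = set ys"
proof (intro equalityI subsetI)
  note D = signed_cyclesD[OF sc]
  fix i assume "i \<in> {i. i \<in> signed_points N \<and> i \<noteq> x \<and> (reflection x i, g) \<in> absolute_order N}"
  then have i: "i \<noteq> x" "(reflection x i, g) \<in> absolute_order N" by auto
  let ?S = "set (x # ys)"
  have S: "?S \<subseteq> signed_points N" "distinct (map abs (x # ys))" using D(2,3) by auto
  have "g ` ?S \<subseteq> ?S" using traces_image[OF D(5), of "x # ys"] by auto
  then have "odd_indicator ?S \<in> fixed_vectors N g"
    using distinct_abs_uminus[OF S(2,1)] S by (intro odd_indicator_fixed[OF D(1)]) auto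
  from reflection_le_fixed[OF i(2) this] have "i \<in> ?S"
    by (auto simp: odd_indicator_def split: if_splits)
  then show "i \<in> set ys" using i(1) by simp
next
  note D = signed_cyclesD[OF sc]
  fix i assume i: "i \<in> set ys"
  then obtain us vs where ys: "ys = us @ i # vs" by (meson split_list)
  have "(reflection x i, g) \<in> absolute_order N"
    using paired_cycle_split(1) sc unfolding ys by blast
  moreover have "i \<noteq> x" "i \<in> signed_points N" using D(2,3) i by auto
  ultimately show "i \<in> {i. i \<in> signed_points N \<and> i \<noteq> x \<and> (reflection x i, g) \<in> absolute_order N}"
    by simp
qed

text \<open>The first reflection sends the predecessor of \<open>j\<close> back to \<open>x\<close>, the second one sends it
  to \<open>- x\<close>. So the sign decides which of the two pieces closes up and which one remains
  self-opposite.\<close>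

lemma zero_cycle_split:
  assumes sc: "signed_cycles N g (x # us @ j # vs) xss"
  shows "(reflection x j, g) \<in> absolute_order N"
    "signed_cycles N (reflection x j \<circ> g) (j # vs) ((x # us) # xss)"
    "(reflection x (- j), g) \<in> absolute_order N"
    "signed_cycles N (reflection x (- j) \<circ> g) (x # us) ((j # vs) # xss)"
proof -
  note D = signed_cyclesD[OF sc]
  let ?t = "reflection x j" and ?s = "reflection x (- j)"
  have dist: "distinct (map abs (x # us @ j # vs))"
    using D(2) by (simp add: Int_Un_distrib)
  have pts: "x \<in> signed_points N" "j \<in> signed_points N" "- j \<in> signed_points N"
    "set us \<subseteq> signed_points N" "set vs \<subseteq> signed_points N" using D(3) by auto
  have ne: "x \<noteq> j" "x \<noteq> - j" using dist by auto
  have nz: "x \<noteq> 0" "j \<noteq> 0" "- j \<noteq> 0" using pts by (auto simp: signed_points_def)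
  have notin: "\<bar>x\<bar> \<notin> abs ` (set us \<union> set vs)" "\<bar>j\<bar> \<notin> abs ` (set us \<union> set vs)"
    using dist by (simp_all add: image_Un)
  have other: "?t k = k" "?s k = k" if "k \<in> set us \<union> set vs" for k
    using notin[THEN abs_notin_image, OF that] by (simp_all add: reflection_other)
  have "traces g ((x # us) @ (j # vs)) (- x)" using D(4) by simp
  then have tr: "traces g (x # us) j" "traces g (j # vs) (- x)"
    by (subst (asm) traces_append; simp)+
  have "?s j = - x" using reflection_simps(4)[of x "- j"] nz by simp
  then have t: "traces (?t \<circ> g) (x # us) x" "traces (?t \<circ> g) (j # vs) (- j)"
    "traces (?s \<circ> g) (x # us) (- x)" "traces (?s \<circ> g) (j # vs) j"
    using traces_comp[OF tr(1), of ?t] traces_comp[OF tr(2), of ?t]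
      traces_comp[OF tr(1), of ?s] traces_comp[OF tr(2), of ?s] other nz by simp_all
  show "signed_cycles N (?t \<circ> g) (j # vs) ((x # us) # xss)"
    using signed_cycles_step[OF sc, of "[]" xss x j "j # vs" "[x # us]"] pts t by simp
  show "signed_cycles N (?s \<circ> g) (x # us) ((j # vs) # xss)"
    using signed_cycles_step[OF sc, of "[]" xss x "- j" "x # us" "[j # vs]"] pts t by simp
  have zero: "v x = 0" "v j = 0" if v: "v \<in> fixed_vectors N g" for v
  proof -
    have "v x = v j" using fixed_vector_traces[OF v tr(1)] by simp
    moreover have "v j = v (- x)" using fixed_vector_traces[OF v tr(2)] by simp
    moreover have "v (- x) = - v x" using fixed_vectorsD(1)[OF v] by (rule odd_vectorsD)
    ultimately show "v x = 0" "v j = 0" using three_eq_minus_iff[of "v x"] by auto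
  qed
  show "(?t, g) \<in> absolute_order N"
  proof (rule reflection_le_by_cycle[OF D(1) pts(1,2) ne(1)])
    show "v x = v j" if "v \<in> fixed_vectors N g" for v
      using zero[OF that] by simp
    show "traces (?t \<circ> g) (x # us) (hd (x # us))" using t by simp
    show "g (last (x # us)) \<notin> set (x # us)"
      using traces_last[OF tr(1)] dist by auto
  qed (use dist pts in auto)
  show "(?s, g) \<in> absolute_order N"
  proof (rule reflection_le_by_cycle[OF D(1) pts(1,3) ne(2)])
    show "traces (?s \<circ> g) (j # vs) (hd (j # vs))" using t by simp
    show "g (last (j # vs)) \<notin> set (j # vs)"
    proof -
      have "- x \<notin> set (j # vs)" using ne notin(1) abs_notin_image[of "\<bar>x\<bar>" "set vs" "- x"] by auto
      then show ?thesis using traces_last[OF tr(2)] by simp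
    qed
    show "v x = v (- j)" if "v \<in> fixed_vectors N g" for v
      using zero[OF that] odd_vectorsD(1)[OF fixed_vectorsD(1)[OF that], of j] by simp
  qed (use dist pts in auto)
qed

text \<open>After the sign change the last point of the list returns to \<open>x\<close> instead of passing on
  to \<open>- x\<close>.\<close>

lemma zero_cycle_open:
  assumes sc: "signed_cycles N g (x # ys) xss"
  shows "(reflection x (- x), g) \<in> absolute_order N"
    "signed_cycles N (reflection x (- x) \<circ> g) [] ((x # ys) # xss)"
proof -
  note D = signed_cyclesD[OF sc]
  let ?t = "reflection x (- x)"
  have dist: "distinct (map abs (x # ys))" using D(2) by simp
  have pts: "x \<in> signed_points N" "- x \<in> signed_points N" "set ys \<subseteq> signed_points N" using D(3) by auto
  have nz: "x \<noteq> 0" "x \<noteq> - x" using pts by (auto simp: signed_points_def)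
  have tr: "traces g (x # ys) (- x)" using D(4) by simp
  have "?t k = k" if "k \<in> set ys" for k
    using dist abs_notin_image[of "\<bar>x\<bar>" "set ys" k] that by (simp add: reflection_other)
  then have t: "traces (?t \<circ> g) (x # ys) x"
    using traces_comp[OF tr, of ?t] nz by simp
  show "signed_cycles N (?t \<circ> g) [] ((x # ys) # xss)"
    using signed_cycles_step[OF sc, of "[]" xss x "- x" "[]" "[x # ys]"] pts t by simp
  show "(?t, g) \<in> absolute_order N"
  proof (rule reflection_le_by_cycle[OF D(1) pts(1,2) nz(2)])
    show "v x = v (- x)" if "v \<in> fixed_vectors N g" for v
      using fixed_vector_traces[OF that tr] by simp
    show "traces (?t \<circ> g) (x # ys) (hd (x # ys))" using t by simp
    have "- x \<notin> set (x # ys)" using dist nz abs_notin_image[of "\<bar>x\<bar>" "set ys" "- x"] by auto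
    then show "g (last (x # ys)) \<notin> set (x # ys)"
      using traces_last[OF tr] by simp
  qed (use dist pts in auto)
qed

text \<open>Fixed vectors vanish on the self-opposite cycle, whereas every other point lies in the
  support of the indicator of its cycle.\<close>

lemma below_zero_cycle:
  assumes sc: "signed_cycles N g (x # ys) xss"
  shows "{i. i \<in> signed_points N \<and> i \<noteq> x \<and> (reflection x i, g) \<in> absolute_order N}
    = insert (- x) (set ys \<union> uminus ` set ys)"
proof (intro equalityI subsetI)
  note D = signed_cyclesD[OF sc]
  fix i assume "i \<in> {i. i \<in> signed_points N \<and> i \<noteq> x \<and> (reflection x i, g) \<in> absolute_order N}"
  then have i: "i \<in> signed_points N" "i \<noteq> x" "(reflection x i, g) \<in> absolute_order N" by auto
  have tr: "traces g (x # ys) (- x)" using D(4) by simp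
  have vi: "v i = 0" if v: "v \<in> fixed_vectors N g" for v
  proof -
    have "v x = v (- x)" using fixed_vector_traces[OF v tr] by simp
    moreover have "v (- x) = - v x" using fixed_vectorsD(1)[OF v] by (rule odd_vectorsD)
    ultimately show ?thesis
      using three_eq_minus_iff[of "v x"] reflection_le_fixed[OF i(3) v] by auto
  qed
  have no_set: "\<not> (i \<in> S \<or> - i \<in> S)"
    if S: "S \<subseteq> signed_points N" "\<And>k. k \<in> S \<Longrightarrow> - k \<notin> S" "g ` S \<subseteq> S" for S
    using vi[OF odd_indicator_fixed[OF D(1) S]] by (auto simp: odd_indicator_def split: if_splits)
  have "i \<in> set (x # ys) \<or> - i \<in> set (x # ys)"
  proof (rule ccontr)
    assume no: "\<not> ?thesis"
    show False
    proof (cases "\<bar>i\<bar> \<in> abs ` set ((x # ys) @ concat xss)")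
      case True
      then obtain k where "k \<in> set ((x # ys) @ concat xss)" "\<bar>i\<bar> = \<bar>k\<bar>" by blast
      then have "i \<in> set ((x # ys) @ concat xss) \<or> - i \<in> set ((x # ys) @ concat xss)"
        by (metis abs_eq_iff add.inverse_inverse)
      then obtain xs where xs: "xs \<in> set xss" "i \<in> set xs \<or> - i \<in> set xs" using no by auto
      obtain as bs where "xss = as @ xs # bs" using split_list[OF xs(1)] by blast
      then have S: "set xs \<subseteq> signed_points N" "distinct (map abs xs)" using D(2,3) by auto
      have "xs \<noteq> []" using xs by auto
      then have "g ` set xs \<subseteq> set xs"
        using traces_image[OF D(5)[OF xs(1)]] by (cases xs) auto
      then show False
        using no_set[OF S(1)] distinct_abs_uminus[OF S(2,1)] xs(2) by blast
    next
      case False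
      then have "g i = i" using D(6) by blast
      then show False using no_set[of "{i}"] i(1) signed_points_neq(1)[OF i(1)] by auto
    qed
  qed
  then show "i \<in> insert (- x) (set ys \<union> uminus ` set ys)"
    using i(2) by (auto simp: image_iff) (metis add.inverse_inverse)+
next
  note D = signed_cyclesD[OF sc]
  fix i assume i: "i \<in> insert (- x) (set ys \<union> uminus ` set ys)"
  have "(reflection x i, g) \<in> absolute_order N"
  proof -
    have "(reflection x j, g) \<in> absolute_order N" "(reflection x (- j), g) \<in> absolute_order N"
      if j: "j \<in> set ys" for j
    proof -
      obtain us vs where "ys = us @ j # vs" using split_list[OF j] by blast
      then show "(reflection x j, g) \<in> absolute_order N" "(reflection x (- j), g) \<in> absolute_order N"
        using zero_cycle_split(1,3) sc by blast+
    qed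
    then show ?thesis using i zero_cycle_open(1)[OF sc] by blast
  qed
  moreover have "i \<noteq> x"
  proof
    assume "i = x"
    moreover have "x \<noteq> - x" using D(3) by (auto simp: signed_points_def)
    ultimately have "\<bar>x\<bar> \<in> abs ` set ys" using i by force
    then show False using D(2) by auto
  qed
  moreover have "i \<in> signed_points N" using i D(3) by auto
  ultimately show "i \<in> {i. i \<in> signed_points N \<and> i \<noteq> x \<and> (reflection x i, g) \<in> absolute_order N}"
    by simp
qed

lemma sum_set_nth: "distinct xs \<Longrightarrow> sum f (set xs) = (\<Sum>k<length xs. f (xs ! k))"
  using sum.reindex_bij_betw[OF bij_betw_nth[of xs "{..<length xs}" "set xs"], of f] by simp

text \<open>The recursion is applied at the first point of the self-opposite cycle, if there is
  one, and otherwise at the first point of a non-trivial cycle.\<close>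

lemma group_moebius_signed_cycles:
  assumes "signed_cycles N g zs xss"
  shows "real_of_int (group_moebius N g) = moebius_B (length zs) * (\<Prod>xs\<leftarrow>xss. moebius_A (length xs))"
  using assms
\<comment> \<open>Each point of \<open>zs\<close> weighs more than a point of \<open>xss\<close>, and the \<open>- 1\<close> for each list
  makes splitting a list and dropping a singleton decrease the measure.\<close>
proof (induction "3 * length zs + (\<Sum>xs\<leftarrow>xss. 2 * length xs - 1)" arbitrary: g zs xss rule: less_induct)
  case less
  note sc = less.prems
  note D = signed_cyclesD[OF sc]
  let ?M = "\<lambda>g. real_of_int (group_moebius N g)" and ?P = "\<lambda>xss. \<Prod>xs\<leftarrow>xss. moebius_A (length xs)"
  show ?case
  proof (cases zs)
    case (Cons x ys)
    let ?f = "\<lambda>i. ?M (reflection x i \<circ> g)" and ?L = "length ys"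
    have sc': "signed_cycles N g (x # ys) xss" using sc Cons by simp
    have x: "x \<in> signed_points N" using D(3) Cons by simp
    have dist: "distinct (map abs (x # ys))" using D(2) Cons by simp
    then have dys: "distinct ys" by (auto simp: distinct_map)
    have gx: "g x \<noteq> x"
    proof
      assume "g x = x"
      moreover have "g x \<in> insert (- x) (set ys)" using traces_image[OF D(4)] Cons by auto
      ultimately show False using dist x by (auto simp: signed_points_def)
    qed
    have "\<bar>x\<bar> \<notin> abs ` set ys" using dist by simp
    from abs_notin_image[OF this] have disj: "set ys \<inter> uminus ` set ys = {}" "- x \<notin> set ys \<union> uminus ` set ys"
      using distinct_abs_uminus[of ys N] dist D(3) Cons by force+
    have "?M g = - (\<Sum>i\<in>insert (- x) (set ys \<union> uminus ` set ys). ?f i)"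
      using group_moebius_recursion[OF D(1) x gx] unfolding below_zero_cycle[OF sc'] by simp
    also have "(\<Sum>i\<in>insert (- x) (set ys \<union> uminus ` set ys). ?f i)
        = ?f (- x) + ((\<Sum>i\<in>set ys. ?f i) + (\<Sum>i\<in>set ys. ?f (- i)))"
      using disj by (subst sum.insert) (auto simp: sum.union_disjoint sum.reindex)
    also have "?f (- x) = moebius_A (Suc ?L) * ?P xss"
      using less.hyps[OF _ zero_cycle_open(2)[OF sc']] Cons by (simp add: moebius_B_def)
    also have "(\<Sum>i\<in>set ys. ?f i) = (\<Sum>k<?L. moebius_A (Suc k) * moebius_B (?L - k)) * ?P xss"
    proof -
      have "?f (ys ! k) = moebius_A (Suc k) * moebius_B (?L - k) * ?P xss" if k: "k < ?L" for k
      proof -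
        obtain us vs where ys: "ys = us @ (ys ! k) # vs" "length us = k" "length vs = ?L - Suc k"
          using split_at_nth[OF k] .
        have "signed_cycles N (reflection x (ys ! k) \<circ> g) ((ys ! k) # vs) ((x # us) # xss)"
          using zero_cycle_split(2)[of N g x us "ys ! k" vs xss] sc' ys(1) by simp
        from less.hyps[OF _ this] show ?thesis
          using k ys(2,3) Cons by (simp add: Suc_diff_Suc)
      qed
      then show ?thesis unfolding sum_set_nth[OF dys] sum_distrib_right by (intro sum.cong) auto
    qed
    also have "(\<Sum>i\<in>set ys. ?f (- i)) = (\<Sum>k<?L. moebius_B (Suc k) * moebius_A (?L - k)) * ?P xss"
    proof -
      have "?f (- (ys ! k)) = moebius_B (Suc k) * moebius_A (?L - k) * ?P xss" if k: "k < ?L" for k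
      proof -
        obtain us vs where ys: "ys = us @ (ys ! k) # vs" "length us = k" "length vs = ?L - Suc k"
          using split_at_nth[OF k] .
        have "signed_cycles N (reflection x (- (ys ! k)) \<circ> g) (x # us) (((ys ! k) # vs) # xss)"
          using zero_cycle_split(4)[of N g x us "ys ! k" vs xss] sc' ys(1) by simp
        from less.hyps[OF _ this] show ?thesis
          using k ys(2,3) Cons by (simp add: Suc_diff_Suc)
      qed
      then show ?thesis unfolding sum_set_nth[OF dys] sum_distrib_right by (intro sum.cong) auto
    qed
    finally have "?M g = - (moebius_A (Suc ?L) + (\<Sum>k<?L. moebius_A (Suc k) * moebius_B (?L - k))
        + (\<Sum>k<?L. moebius_B (Suc k) * moebius_A (?L - k))) * ?P xss"
      by (simp only: distrib_right minus_mult_left[symmetric] add.assoc)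
    then show ?thesis
      unfolding moebius_B_recursion[symmetric] using Cons by simp
  next
    case Nil
    note zs = this
    show ?thesis
    proof (cases xss)
      case Nil
      then have "g = id" using D(6) zs by (auto simp: fun_eq_iff)
      then show ?thesis using zs Nil by (simp add: moebius_B_def)
    next
      case (Cons xs rest)
      then obtain x ys where xs: "xs = x # ys"
        using D(5)[of xs] by (cases xs) (auto simp: traces_def)
      have sc': "signed_cycles N g [] ((x # ys) # rest)" using sc Cons xs zs by simp
      have tr: "traces g (x # ys) x" using D(5)[of xs] Cons xs by simp
      have x: "x \<in> signed_points N" using D(3) Cons xs by simp
      have dist: "distinct (map abs (x # ys))" using D(2) Cons xs by simp
      then have dys: "distinct ys" by (auto simp: distinct_map)
      show ?thesis
      proof (cases ys)
        case Nil
        have gx: "g x = x" using tr Nil by (simp add: traces_def)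
        have "signed_cycles N g [] rest"
          unfolding signed_cycles_def
        proof (intro conjI allI impI)
          fix k assume k: "\<bar>k\<bar> \<notin> abs ` set ([] @ concat rest)"
          show "g k = k"
          proof (cases "\<bar>k\<bar> = \<bar>x\<bar>")
            case True
            then have "k = x \<or> k = - x" by (simp add: abs_eq_iff)
            then show ?thesis using gx hyperoctahedralD(1)[OF D(1), of x] by auto
          next
            case False
            then show ?thesis using D(6)[of k] k zs Cons xs Nil by auto
          qed
        qed (use D zs Cons in auto)
        from less.hyps[OF _ this] show ?thesis using zs Cons xs Nil by simp
      next
        case ys: (Cons y ys')
        let ?f = "\<lambda>i. ?M (reflection x i \<circ> g)" and ?L = "length ys"
        have gx: "g x \<noteq> x"
        proof -
          have "g x = y" using tr ys by (simp add: traces_def)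
          then show ?thesis using dist ys by auto
        qed
        have "?M g = - (\<Sum>i\<in>set ys. ?f i)"
          using group_moebius_recursion[OF D(1) x gx] unfolding below_paired_cycle[OF sc'] by simp
        also have "(\<Sum>i\<in>set ys. ?f i) = (\<Sum>k<?L. moebius_A (Suc k) * moebius_A (?L - k)) * ?P rest"
        proof -
          have "?f (ys ! k) = moebius_A (Suc k) * moebius_A (?L - k) * ?P rest" if k: "k < ?L" for k
          proof -
            obtain us vs where ys: "ys = us @ (ys ! k) # vs" "length us = k" "length vs = ?L - Suc k"
              using split_at_nth[OF k] .
            have "signed_cycles N (reflection x (ys ! k) \<circ> g) [] ((x # us) # ((ys ! k) # vs) # rest)"
              using paired_cycle_split(2)[of N g "[]" x us "ys ! k" vs rest] sc' ys(1) by simp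
            from less.hyps[OF _ this] show ?thesis
              using k ys(2,3) zs Cons xs by (simp add: Suc_diff_Suc moebius_B_def)
          qed
          then show ?thesis unfolding sum_set_nth[OF dys] sum_distrib_right by (intro sum.cong) auto
        qed
        finally have "?M g = - (\<Sum>k<?L. moebius_A (Suc k) * moebius_A (?L - k)) * ?P rest"
          by (simp only: minus_mult_left)
        also have "- (\<Sum>k<?L. moebius_A (Suc k) * moebius_A (?L - k)) = moebius_A (Suc ?L)"
          using moebius_A_recursion[of ?L] ys by simp
        finally show ?thesis
          using zs Cons xs by (simp add: moebius_B_def)
      qed
    qed
  qed
qed

section \<open>Partitions and fixed spaces\<close>

lemma orbit_uminus:
  assumes "g \<in> hyperoctahedral N"
  shows "orbit g (- i) = uminus ` orbit g i"
proof -
  have *: "- y \<in> orbit g (- i)" if "y \<in> orbit g i" for y i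
    using that
  proof induction
    case base
    then show ?case using orbit.base[of g "- i"] hyperoctahedralD(1)[OF assms] by simp
  next
    case (step y)
    then show ?case using orbit.step[of "- y" g "- i"] hyperoctahedralD(1)[OF assms] by simp
  qed
  show ?thesis
  proof (intro equalityI subsetI)
    fix y assume "y \<in> orbit g (- i)"
    then have "- y \<in> orbit g i" using *[of y "- i"] by simp
    then show "y \<in> uminus ` orbit g i" by (metis add.inverse_inverse image_eqI)
  qed (use * in blast)
qed

lemma orbit_facts:
  assumes g: "g \<in> hyperoctahedral N"
  shows "i \<in> orbit g i" "j \<in> orbit g i \<Longrightarrow> orbit g j = orbit g i"
    "i \<in> signed_points N \<Longrightarrow> orbit g i \<subseteq> signed_points N"
proof -
  have p: "g permutes signed_points N" using g by (simp add: hyperoctahedral_def)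
  have perm: "permutation g"
    using p finite_signed_points permutation_permutes by blast
  show "i \<in> orbit g i" using perm by (rule permutation_self_in_orbit)
  show "j \<in> orbit g i \<Longrightarrow> orbit g j = orbit g i"
    using orbit_cyclic_eq3 cyclic_on_orbit'[OF perm] by metis
  show "i \<in> signed_points N \<Longrightarrow> orbit g i \<subseteq> signed_points N"
    by (rule permutes_orbit_subset[OF p])
qed

lemma fixed_vector_orbit:
  assumes "v \<in> fixed_vectors N g" "j \<in> orbit g i"
  shows "v j = v i"
  using assms(2) by induction (simp_all add: fixed_vectorsD(2)[OF assms(1)])

text \<open>The coordinates that no fixed vector of \<open>g\<close> separates from \<open>i\<close>.\<close>

definition fixed_block :: "nat \<Rightarrow> (int \<Rightarrow> int) \<Rightarrow> int \<Rightarrow> int set" where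
  "fixed_block N g i = {j \<in> signed_points N. \<forall>v\<in>fixed_vectors N g. v j = v i}"

lemma fixed_vector_inversion_invariant:
  assumes "g \<in> hyperoctahedral N" "v \<in> fixed_vectors N g" "uminus ` orbit g i = orbit g i"
  shows "v i = 0"
proof -
  have "- i \<in> orbit g i" using assms(3) orbit_facts(1)[OF assms(1), of i] by blast
  then have "v (- i) = v i" by (rule fixed_vector_orbit[OF assms(2)])
  then show ?thesis
    using odd_vectorsD(1)[OF fixed_vectorsD(1)[OF assms(2)], of i] three_eq_minus_iff[of "v i"] by simp
qed

lemma orbit_indicator_fixed:
  assumes g: "g \<in> hyperoctahedral N" and i: "i \<in> signed_points N"
    and non: "uminus ` orbit g i \<noteq> orbit g i"
  shows "odd_indicator (orbit g i) \<in> fixed_vectors N g"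
proof (rule odd_indicator_fixed[OF g orbit_facts(3)[OF g i]])
  fix k assume k: "k \<in> orbit g i"
  show "- k \<notin> orbit g i"
  proof
    assume "- k \<in> orbit g i"
    then have "orbit g (- k) = orbit g k" using orbit_facts(2)[OF g] k by metis
    then have "uminus ` orbit g k = orbit g k" using orbit_uminus[OF g] by metis
    then show False using non orbit_facts(2)[OF g k] by simp
  qed
next
  show "g ` orbit g i \<subseteq> orbit g i" by (auto intro: orbit.step)
qed

text \<open>Fixed vectors are constant on orbits and vanish on the inversion-invariant ones; the
  indicators of the other orbits separate everything else. This is the reason for
  merging the inversion-invariant orbits.\<close>

lemma fixed_block_eq:
  assumes g: "g \<in> hyperoctahedral N" and i: "i \<in> signed_points N"
  shows "fixed_block N g i = (if uminus ` orbit g i = orbit g i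
    then \<Union> {A \<in> Omega N g. uminus ` A = A} else orbit g i)"
proof (cases "uminus ` orbit g i = orbit g i")
  case True
  have "j \<in> fixed_block N g i \<longleftrightarrow> j \<in> \<Union> {A \<in> Omega N g. uminus ` A = A}" for j
  proof
    assume j: "j \<in> fixed_block N g i"
    then have jp: "j \<in> signed_points N" by (simp add: fixed_block_def)
    have "uminus ` orbit g j = orbit g j"
    proof (rule ccontr)
      assume n: "uminus ` orbit g j \<noteq> orbit g j"
      let ?v = "odd_indicator (orbit g j)"
      have v: "?v \<in> fixed_vectors N g" by (rule orbit_indicator_fixed[OF g jp n])
      have "?v j = ?v i" using j v by (simp add: fixed_block_def)
      also have "?v i = 0" by (rule fixed_vector_inversion_invariant[OF g v True])
      finally show False using orbit_facts(1)[OF g, of j] by (simp add: odd_indicator_def)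
    qed
    then show "j \<in> \<Union> {A \<in> Omega N g. uminus ` A = A}"
      using jp orbit_facts(1)[OF g, of j] by (auto simp: Omega_def)
  next
    assume "j \<in> \<Union> {A \<in> Omega N g. uminus ` A = A}"
    then obtain k where k: "k \<in> signed_points N" "j \<in> orbit g k" "uminus ` orbit g k = orbit g k"
      by (auto simp: Omega_def)
    then have j: "j \<in> signed_points N" "uminus ` orbit g j = orbit g j"
      using orbit_facts(3)[OF g k(1)] orbit_facts(2)[OF g k(2)] by auto
    have "v j = v i" if "v \<in> fixed_vectors N g" for v
      using fixed_vector_inversion_invariant[OF g that True]
        fixed_vector_inversion_invariant[OF g that j(2)] by simp
    then show "j \<in> fixed_block N g i" using j(1) by (simp add: fixed_block_def)
  qed
  then show ?thesis using True by auto
next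
  case False
  let ?v = "odd_indicator (orbit g i)"
  have v: "?v \<in> fixed_vectors N g" by (rule orbit_indicator_fixed[OF g i False])
  have "fixed_block N g i \<subseteq> orbit g i"
  proof
    fix j assume "j \<in> fixed_block N g i"
    then have "?v j = ?v i" using v by (simp add: fixed_block_def)
    then show "j \<in> orbit g i"
      using orbit_facts(1)[OF g, of i] by (simp add: odd_indicator_def split: if_splits)
  qed
  moreover have "orbit g i \<subseteq> fixed_block N g i"
    using fixed_vector_orbit orbit_facts(3)[OF g i] by (auto simp: fixed_block_def)
  ultimately show ?thesis using False by auto
qed

lemma Omega_tilde_eq_fixed_blocks:
  assumes g: "g \<in> hyperoctahedral N"
  shows "Omega_tilde N g = fixed_block N g ` signed_points N"
proof -
  let ?Z = "{A \<in> Omega N g. uminus ` A = A}"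
  have "fixed_block N g ` signed_points N
      = (\<lambda>A. if uminus ` A = A then \<Union> ?Z else A) ` Omega N g"
    unfolding Omega_def image_image by (intro image_cong refl) (simp add: fixed_block_eq[OF g] Omega_def)
  also have "\<dots> = Omega_tilde N g"
    unfolding Omega_tilde_def Let_def by auto
  finally show ?thesis ..
qed

lemma Omega_tilde_refines_iff:
  assumes x: "x \<in> hyperoctahedral N" and y: "y \<in> hyperoctahedral N"
  shows "(\<forall>A\<in>Omega_tilde N x. \<exists>B\<in>Omega_tilde N y. A \<subseteq> B) \<longleftrightarrow> fixed_vectors N y \<subseteq> fixed_vectors N x"
proof
  assume "fixed_vectors N y \<subseteq> fixed_vectors N x"
  then have "fixed_block N x i \<subseteq> fixed_block N y i" for i
    by (auto simp: fixed_block_def)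
  then show "\<forall>A\<in>Omega_tilde N x. \<exists>B\<in>Omega_tilde N y. A \<subseteq> B"
    unfolding Omega_tilde_eq_fixed_blocks[OF x] Omega_tilde_eq_fixed_blocks[OF y] by blast
next
  assume ref: "\<forall>A\<in>Omega_tilde N x. \<exists>B\<in>Omega_tilde N y. A \<subseteq> B"
  show "fixed_vectors N y \<subseteq> fixed_vectors N x"
  proof
    fix v assume v: "v \<in> fixed_vectors N y"
    have "v (x i) = v i" for i
    proof (cases "i \<in> signed_points N")
      case True
      then obtain k where "fixed_block N x i \<subseteq> fixed_block N y k"
        using ref unfolding Omega_tilde_eq_fixed_blocks[OF x] Omega_tilde_eq_fixed_blocks[OF y] by blast
      moreover have "i \<in> fixed_block N x i" "x i \<in> fixed_block N x i"
        using True hyperoctahedralD(3)[OF x] by (auto simp: fixed_block_def fixed_vectorsD(2))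
      ultimately have "i \<in> fixed_block N y k" "x i \<in> fixed_block N y k" by blast+
      then have "v i = v k" "v (x i) = v k" using v unfolding fixed_block_def by blast+
      then show ?thesis by (rule trans[OF _ sym, rotated])
    qed (simp add: hyperoctahedralD(4)[OF x])
    then show "v \<in> fixed_vectors N x" using v by (simp add: fixed_vectors_def fun_eq_iff)
  qed
qed

section \<open>Below a common bound, inclusion of fixed spaces is the absolute order\<close>

text \<open>A subgroup containing all coordinate vectors is everything: subtracting a coordinate
  vector where \<open>v\<close> takes the value \<open>1\<close> shrinks the support. By oddness such a coordinate
  exists for every \<open>v \<noteq> 0\<close>, as the only non-zero scalars are \<open>\<plusminus>1\<close>.\<close>

lemma odd_vectors_generated:
  assumes diff: "\<And>u v. u \<in> H \<Longrightarrow> v \<in> H \<Longrightarrow> u - v \<in> H" and "0 \<in> H"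
    and gen: "\<And>i. i \<in> signed_points N \<Longrightarrow> odd_indicator {i} \<in> H"
    and v: "v \<in> odd_vectors N"
  shows "v \<in> H"
  using v
proof (induction "card {i. v i \<noteq> 0}" arbitrary: v rule: less_induct)
  case less
  show ?case
  proof (cases "v = 0")
    case False
    then obtain j where "v j \<noteq> 0" by (auto simp: fun_eq_iff)
    then have "v j = 1 \<or> v (- j) = 1"
      using three_cases[of "v j"] odd_vectorsD(1)[OF less.prems, of j] by auto
    then obtain i where i: "v i = 1" by blast
    have ip: "i \<in> signed_points N" using odd_vectorsD(2)[OF less.prems, of i] i by auto
    let ?e = "odd_indicator {i}"
    have ne: "i \<noteq> - i" using signed_points_neq(1)[OF ip] .
    have e: "?e \<in> odd_vectors N" using ip ne by (intro odd_indicator_odd_vector) auto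
    have "{k. (v - ?e) k \<noteq> 0} \<subset> {k. v k \<noteq> 0}"
    proof
      have "(v - ?e) k = 0" if "v k = 0" for k
        using that i odd_vectorsD(1)[OF less.prems, of i] by (auto simp: odd_indicator_def)
      then show "{k. (v - ?e) k \<noteq> 0} \<subseteq> {k. v k \<noteq> 0}" by blast
      show "{k. (v - ?e) k \<noteq> 0} \<noteq> {k. v k \<noteq> 0}"
        using i by (auto simp: odd_indicator_def dest!: equalityD2 subsetD[of _ _ i])
    qed
    moreover have "finite {k. v k \<noteq> 0}"
      by (rule finite_subset[OF _ finite_signed_points[of N]])
        (use odd_vectorsD(2)[OF less.prems] in auto)
    ultimately have "card {k. (v - ?e) k \<noteq> 0} < card {k. v k \<noteq> 0}"
      by (rule psubset_card_mono[rotated])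
    then have "v - ?e \<in> H" using less.hyps less.prems e by blast
    moreover have "0 - ?e \<in> H" using diff \<open>0 \<in> H\<close> gen[OF ip] by blast
    ultimately have "(v - ?e) - (0 - ?e) \<in> H" by (rule diff)
    then show ?thesis by simp
  qed (use \<open>0 \<in> H\<close> in simp)
qed

text \<open>The image of \<open>g - 1\<close>. Its role is dual to that of the fixed space: it determines on
  which vectors an element below \<open>c\<close> agrees with \<open>c\<close>.\<close>

definition moved_vectors :: "nat \<Rightarrow> (int \<Rightarrow> int) \<Rightarrow> (int \<Rightarrow> 3) set" where
  "moved_vectors N g = (\<lambda>u. (u \<circ> g) - u) ` odd_vectors N"

lemma moved_vectors_diff:
  assumes "a \<in> moved_vectors N g" "b \<in> moved_vectors N g"
  shows "a - b \<in> moved_vectors N g"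
proof -
  obtain u w where "u \<in> odd_vectors N" "a = (u \<circ> g) - u" "w \<in> odd_vectors N" "b = (w \<circ> g) - w"
    using assms unfolding moved_vectors_def by blast
  then have "u - w \<in> odd_vectors N" "a - b = ((u - w) \<circ> g) - (u - w)"
    by (auto simp: diff_comp)
  then show ?thesis unfolding moved_vectors_def by blast
qed

lemma zero_moved [simp]: "0 \<in> moved_vectors N g"
  unfolding moved_vectors_def by (rule image_eqI[of _ _ 0]) (auto simp: fun_eq_iff)

lemma card_moved_vectors:
  assumes g: "g \<in> hyperoctahedral N"
  shows "card (moved_vectors N g) = 3 ^ B_length N g"
proof -
  have "card (odd_vectors N) = card {v \<in> odd_vectors N. (v \<circ> g) - v = 0} * card (moved_vectors N g)"
    unfolding moved_vectors_def by (rule card_additive) (auto simp: finite_odd_vectors diff_comp)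
  also have "{v \<in> odd_vectors N. (v \<circ> g) - v = 0} = fixed_vectors N g"
    by (simp add: fixed_vectors_def)
  finally have "card (moved_vectors N g) * card (fixed_vectors N g) = 3 ^ B_length N g * card (fixed_vectors N g)"
    using B_length_fixed_vectors[OF g] by (metis mult.commute)
  then show ?thesis using card_fixed_vectors_pos[of N g] by (metis mult_right_cancel less_numeral_extra(3))
qed

lemma odd_indicator_uminus: "i \<noteq> 0 \<Longrightarrow> odd_indicator {- i} = - odd_indicator {i :: int}"
  by (auto simp: odd_indicator_def fun_eq_iff)

text \<open>The moved space contains the differences of coordinate vectors along each orbit. On an
  inversion-invariant orbit it therefore contains twice a coordinate vector, hence the
  coordinate vector itself.\<close>

lemma odd_indicator_diff_moved:
  assumes g: "g \<in> hyperoctahedral N" and i: "i \<in> signed_points N"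
    and j: "j \<in> fixed_block N g i"
  shows "odd_indicator {j} - odd_indicator {i} \<in> moved_vectors N g"
proof -
  let ?e = "\<lambda>i. odd_indicator {i}" and ?M = "moved_vectors N g"
  have sym: "b - a \<in> ?M" if "a - b \<in> ?M" for a b
    using moved_vectors_diff[OF zero_moved that] by simp
  have trans: "a - c \<in> ?M" if "a - b \<in> ?M" "b - c \<in> ?M" for a b c
    using moved_vectors_diff[OF that(1) sym[OF that(2)]] by simp
  have step: "?e (g k) - ?e k \<in> ?M" if k: "k \<in> signed_points N" for k
  proof -
    have gk: "g k \<in> signed_points N" using hyperoctahedralD(3)[OF g] k by simp
    then have "?e (g k) \<in> odd_vectors N"
      using signed_points_neq(1) by (intro odd_indicator_odd_vector) auto
    moreover have "?e (g k) \<circ> g = ?e k"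
    proof
      fix l
      have inj: "g a = g b \<longleftrightarrow> a = b" for a b
        using hyperoctahedralD(2)[OF g] by (simp add: bij_is_inj inj_eq)
      show "(?e (g k) \<circ> g) l = ?e k l"
        unfolding odd_indicator_def comp_apply hyperoctahedralD(1)[OF g, symmetric] singleton_iff inj ..
    qed
    ultimately have "?e k - ?e (g k) \<in> ?M"
      unfolding moved_vectors_def by (intro image_eqI[of _ _ "?e (g k)"]) simp_all
    then show ?thesis by (rule sym)
  qed
  have orb: "?e j - ?e k \<in> ?M" if "j \<in> orbit g k" "k \<in> signed_points N" for j k
    using that(1)
  proof induction
    case base
    then show ?case using step that(2) by blast
  next
    case (step l)
    have "l \<in> signed_points N" using orbit_facts(3)[OF g that(2)] step.hyps by blast
    then show ?case using trans \<open>?e l - ?e k \<in> ?M\<close> \<open>\<And>k. k \<in> signed_points N \<Longrightarrow> ?e (g k) - ?e k \<in> ?M\<close> by blast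
  qed
  have inv: "?e k \<in> ?M" if k: "k \<in> signed_points N" "uminus ` orbit g k = orbit g k" for k
  proof -
    have "- k \<in> orbit g k" using k(2) orbit_facts(1)[OF g, of k] by blast
    then have "?e (- k) - ?e k \<in> ?M" using orb k(1) by blast
    moreover have "?e (- k) - ?e k = ?e k"
    proof -
      have "- c - c = c" for c :: 3 using three_cases[of c] by auto
      then show ?thesis using k(1) by (simp add: odd_indicator_uminus signed_points_neq fun_eq_iff)
    qed
    ultimately show ?thesis by simp
  qed
  show ?thesis
  proof (cases "uminus ` orbit g i = orbit g i")
    case True
    then have "j \<in> \<Union> {A \<in> Omega N g. uminus ` A = A}" using j fixed_block_eq[OF g i] by simp
    then obtain k where k: "k \<in> signed_points N" "j \<in> orbit g k" "uminus ` orbit g k = orbit g k"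
      by (auto simp: Omega_def)
    then have "j \<in> signed_points N" "uminus ` orbit g j = orbit g j"
      using orbit_facts(3)[OF g k(1)] orbit_facts(2)[OF g k(2)] by auto
    then show ?thesis using moved_vectors_diff inv[of j] inv[OF i True] by metis
  next
    case False
    then show ?thesis using orb j i fixed_block_eq[OF g i] by simp
  qed
qed

text \<open>Passing from fixed to moved spaces reverses inclusions. It suffices to check this on
  coordinate vectors, where it says that \<open>i\<close> and \<open>inv x i\<close> lie in one block of \<open>y\<close>.\<close>

lemma moved_subset:
  assumes x: "x \<in> hyperoctahedral N" and y: "y \<in> hyperoctahedral N"
    and fix_sub: "fixed_vectors N y \<subseteq> fixed_vectors N x" and v: "v \<in> odd_vectors N"
  shows "(v \<circ> x) - v \<in> moved_vectors N y"
proof -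
  let ?H = "{v. (v \<circ> x) - v \<in> moved_vectors N y}"
  have "v \<in> ?H"
  proof (rule odd_vectors_generated[OF _ _ _ v])
    fix a b :: "int \<Rightarrow> 3" assume "a \<in> ?H" "b \<in> ?H"
    then have "((a \<circ> x) - a) - ((b \<circ> x) - b) \<in> moved_vectors N y"
      using moved_vectors_diff by blast
    moreover have "((a \<circ> x) - a) - ((b \<circ> x) - b) = ((a - b) \<circ> x) - (a - b)"
      by (simp add: diff_comp)
    ultimately show "a - b \<in> ?H" by simp
  next
    have "((0 :: int \<Rightarrow> 3) \<circ> x) - 0 = 0" by (simp add: fun_eq_iff)
    then show "0 \<in> ?H" by simp
  next
    fix i assume i: "i \<in> signed_points N"
    have ix: "inv x \<in> hyperoctahedral N" using x by simp
    have "odd_indicator {i} \<circ> x = odd_indicator {inv x i}"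
    proof
      fix l
      have "x l = i \<longleftrightarrow> l = inv x i" "- x l = i \<longleftrightarrow> - l = inv x i" for l
        using x hyperoctahedralD(1)[OF x, of l] by (metis hyperoctahedral_cancel(6,7))+
      then show "(odd_indicator {i} \<circ> x) l = odd_indicator {inv x i} l"
        by (simp add: odd_indicator_def)
    qed
    moreover have "inv x i \<in> fixed_block N y i"
    proof -
      have "inv x i \<in> signed_points N" using hyperoctahedralD(3)[OF ix] i by simp
      moreover have "v (inv x i) = v i" if "v \<in> fixed_vectors N y" for v
        using fixed_vectorsD(2)[of v N x "inv x i"] that fix_sub x by auto
      ultimately show ?thesis by (simp add: fixed_block_def)
    qed
    ultimately show "odd_indicator {i} \<in> ?H"
      using odd_indicator_diff_moved[OF y i] by simp
  qed
  then show ?thesis by simp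
qed

text \<open>The argument of Brady and Watt. For \<open>y \<le> c\<close>, a vector on which \<open>y\<close> and \<open>c\<close> agree is
  moved by \<open>c\<close> into the moved space of \<open>y\<close>, and by counting these are all vectors with
  that property. So a smaller fixed space of \<open>y\<close> makes \<open>y\<close> agree with \<open>c\<close> wherever \<open>x\<close>
  does. Consequently \<open>x\<close> and \<open>y\<close> agree both on the vectors where \<open>x\<close> agrees with \<open>c\<close> and
  on the vectors fixed by \<open>y\<close>; these two spaces intersect only in vectors fixed by \<open>c\<close>,
  so the vectors on which \<open>x\<close> and \<open>y\<close> agree are numerous enough to bound the length of
  \<open>inv x \<circ> y\<close> by the difference of the lengths.\<close>

lemma fixed_vectors_subset_imp_le:
  assumes xc: "(x, c) \<in> absolute_order N" and yc: "(y, c) \<in> absolute_order N"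
    and fix_sub: "fixed_vectors N y \<subseteq> fixed_vectors N x"
  shows "(x, y) \<in> absolute_order N"
proof -
  note X = absolute_orderD[OF xc] and Y = absolute_orderD[OF yc]
  let ?V = "odd_vectors N" and ?l = "B_length N"
  let ?S = "\<lambda>x. {v \<in> ?V. v \<circ> x = v \<circ> c}"
  let ?T = "{v \<in> ?V. (v \<circ> c) - v \<in> moved_vectors N y}"
  let ?E = "{v \<in> ?V. v \<circ> x = v \<circ> y}"
  have Vpos: "card ?V > 0" using card_fixed_vectors_pos[of N id] by simp
  have finS: "finite {v \<in> ?V. P v}" for P using finite_odd_vectors[of N] by simp
  have cardS: "3 ^ ?l (inv z \<circ> c) * card (?S z) = card ?V" if "z \<in> hyperoctahedral N" for z
    using card_eq_vectors[OF that X(2)] B_length_fixed_vectors[of "inv z \<circ> c" N] that X(2) by simp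
  have "card ?T \<le> card (?S y)"
  proof -
    have "card ?T = card {v \<in> ?T. (v \<circ> c) - v = 0} * card ((\<lambda>v. (v \<circ> c) - v) ` ?T)"
    proof (rule card_additive)
      fix a b assume ab: "a \<in> ?T" "b \<in> ?T"
      then have "((a \<circ> c) - a) - ((b \<circ> c) - b) \<in> moved_vectors N y" using moved_vectors_diff by blast
      moreover have "((a \<circ> c) - a) - ((b \<circ> c) - b) = ((a - b) \<circ> c) - (a - b)"
        by (simp add: diff_comp)
      ultimately show "a - b \<in> ?T" using ab by auto
    qed (auto simp: finS diff_comp)
    also have "\<dots> \<le> card (fixed_vectors N c) * card (moved_vectors N y)"
      by (intro mult_mono card_mono) (auto simp: fixed_vectors_def moved_vectors_def finite_odd_vectors)
    also have "\<dots> = card (fixed_vectors N c) * 3 ^ ?l y"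
      by (simp add: card_moved_vectors[OF Y(1)])
    finally have "3 ^ ?l (inv y \<circ> c) * card ?T \<le> 3 ^ ?l (inv y \<circ> c) * (card (fixed_vectors N c) * 3 ^ ?l y)"
      by (rule mult_left_mono) simp
    also have "\<dots> = 3 ^ ?l c * card (fixed_vectors N c)"
      unfolding Y(3) power_add by (simp only: mult_ac)
    also have "\<dots> = 3 ^ ?l (inv y \<circ> c) * card (?S y)"
      unfolding B_length_fixed_vectors[OF X(2)] cardS[OF Y(1)] ..
    finally show ?thesis by simp
  qed
  moreover have "?S y \<subseteq> ?T"
  proof clarify
    fix v assume v: "v \<in> ?V" "v \<circ> y = v \<circ> c"
    show "(v \<circ> c) - v \<in> moved_vectors N y"
      unfolding moved_vectors_def v(2)[symmetric] by (rule image_eqI[OF refl v(1)])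
  qed
  \<comment> \<open>Both sets have the same cardinality, so \<open>y\<close> agrees with \<open>c\<close> wherever \<open>c\<close> moves a
    vector into the moved space of \<open>y\<close>.\<close>
  ultimately have ST: "?S y = ?T" by (intro card_seteq finS)
  have sub: "?S x \<subseteq> ?S y"
    unfolding ST
  proof clarify
    fix v assume v: "v \<in> ?V" "v \<circ> x = v \<circ> c"
    then show "(v \<circ> c) - v \<in> moved_vectors N y"
      using moved_subset[OF X(1) Y(1) fix_sub v(1)] by simp
  qed
  have le1: "card (?S x) * card (fixed_vectors N y) \<le> card (?S x \<inter> fixed_vectors N y) * card ?E"
  proof (rule card_le_mult_Int)
    show "?S x \<subseteq> ?E" using sub by auto
    show "fixed_vectors N y \<subseteq> ?E" using fix_sub by (auto simp: fixed_vectors_def)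
  qed (auto simp: finS diff_comp)
  have le2: "card (?S x \<inter> fixed_vectors N y) \<le> card (fixed_vectors N c)"
  proof (intro card_mono finite_fixed_vectors subsetI)
    fix v assume v: "v \<in> ?S x \<inter> fixed_vectors N y"
    then have "v \<circ> y = v \<circ> c" using sub by auto
    then show "v \<in> fixed_vectors N c" using v by (auto simp: fixed_vectors_def)
  qed
  have le: "card (?S x) * card (fixed_vectors N y) \<le> card (fixed_vectors N c) * card ?E"
    by (rule order_trans[OF le1 mult_right_mono[OF le2]]) simp
  let ?w = "?l (inv x \<circ> y)" and ?d = "?l (inv x \<circ> c)"
  have E: "3 ^ ?w * card ?E = card ?V"
    using card_eq_vectors[OF X(1) Y(1)] B_length_fixed_vectors[of "inv x \<circ> y" N] X(1) Y(1) by simp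
  have "(3 ^ ?d * 3 ^ ?l y * 3 ^ ?l c * 3 ^ ?w) * (card (?S x) * card (fixed_vectors N y))
      \<le> (3 ^ ?d * 3 ^ ?l y * 3 ^ ?l c * 3 ^ ?w) * (card (fixed_vectors N c) * card ?E)"
    using le by (rule mult_left_mono) simp
  also have "(3 ^ ?d * 3 ^ ?l y * 3 ^ ?l c * 3 ^ ?w) * (card (fixed_vectors N c) * card ?E)
      = (3 ^ ?d * 3 ^ ?l y) * ((3 ^ ?l c * card (fixed_vectors N c)) * (3 ^ ?w * card ?E))"
    by (simp only: mult_ac)
  also have "(3 ^ ?d * 3 ^ ?l y * 3 ^ ?l c * 3 ^ ?w) * (card (?S x) * card (fixed_vectors N y))
      = (3 ^ ?l c * 3 ^ ?w) * ((3 ^ ?d * card (?S x)) * (3 ^ ?l y * card (fixed_vectors N y)))"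
    by (simp only: mult_ac)
  finally have "(3::nat) ^ (?l c + ?w) * (card ?V * card ?V) \<le> 3 ^ (?d + ?l y) * (card ?V * card ?V)"
    unfolding cardS[OF X(1)] B_length_fixed_vectors[OF X(2)] B_length_fixed_vectors[OF Y(1)] E power_add .
  then have "(3::nat) ^ (?l c + ?w) \<le> 3 ^ (?d + ?l y)" using Vpos by simp
  then have "?l c + ?w \<le> ?d + ?l y" by (simp only: power_increasing_iff one_less_numeral_iff semiring_norm)
  then have "?l x + ?w \<le> ?l y" using X(3) by simp
  moreover have "?l y \<le> ?l x + ?w"
    using B_length_comp_le[of x N "inv x \<circ> y"] X(1) Y(1) by simp
  ultimately show ?thesis using X(1) Y(1) by (simp add: absolute_order_def B_le_def)
qed

section \<open>Moebius functions of isomorphic intervals\<close>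

text \<open>The Moebius function depends only on the interval, so it can be transported along an
  isomorphism from a down-closed set onto another poset.\<close>

lemma moebius_order_embedding:
  assumes P: "finite P" "partial_order_on P r" and Q: "finite Q" "partial_order_on Q s"
    and D: "D \<subseteq> P" "\<And>z w. w \<in> D \<Longrightarrow> (z, w) \<in> r \<Longrightarrow> z \<in> D"
    and emb: "\<And>z w. z \<in> D \<Longrightarrow> w \<in> D \<Longrightarrow> (z, w) \<in> r \<longleftrightarrow> (f z, f w) \<in> s" and onto: "f ` D = Q"
    and x: "x \<in> D" and y: "y \<in> D"
  shows "moebius P r x y = moebius Q s (f x) (f y)"
  using y
proof (induction "card {z. (z, y) \<in> r}" arbitrary: y rule: less_induct)
  case less
  have r: "r \<subseteq> P \<times> P" "refl_on P r" "trans r" "antisym r" and s: "s \<subseteq> Q \<times> Q" "antisym s" "refl_on Q s"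
    using partial_order_onD P(2) Q(2) by blast+
  have inj: "f z = f w \<longleftrightarrow> z = w" if "z \<in> D" "w \<in> D" for z w
  proof
    assume "f z = f w"
    moreover have "(f z, f z) \<in> s" using s(3) onto that(1) by (auto simp: refl_on_def)
    ultimately have "(z, w) \<in> r" "(w, z) \<in> r" using emb that by auto
    then show "z = w" using r(4) by (auto dest: antisymD)
  qed simp
  show ?case
  proof (cases "(x, y) \<in> r \<and> x \<noteq> y")
    case False
    then have "(f x, f y) \<notin> s \<or> f x = f y" using emb x less.prems by blast
    then show ?thesis
      using False inj[OF x less.prems] emb[OF x less.prems] P Q
      by (subst (1 2) moebius.simps) auto
  next
    case True
    let ?A = "{z. (x, z) \<in> r \<and> (z, y) \<in> r \<and> z \<noteq> y}"
    let ?B = "{z. (f x, z) \<in> s \<and> (z, f y) \<in> s \<and> z \<noteq> f y}"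
    have AD: "?A \<subseteq> D" using D(2) less.prems by blast
    have img: "f ` ?A = ?B"
    proof (intro equalityI subsetI)
      fix w assume "w \<in> f ` ?A"
      then show "w \<in> ?B" using AD emb x less.prems inj by blast
    next
      fix w assume w: "w \<in> ?B"
      then have "w \<in> f ` D" using s(1) onto by blast
      then obtain z where "z \<in> D" "w = f z" by blast
      then show "w \<in> f ` ?A" using w emb[OF x] emb[OF _ less.prems] by blast
    qed
    have "inj_on f ?A" using inj AD unfolding inj_on_def by blast
    then have "(\<Sum>w\<in>?B. moebius Q s (f x) w) = (\<Sum>z\<in>?A. moebius Q s (f x) (f z))"
      unfolding img[symmetric] by (simp add: sum.reindex)
    also have "\<dots> = (\<Sum>z\<in>?A. moebius P r x z)"
    proof (intro sum.cong refl)
      fix z assume z: "z \<in> ?A"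
      have "{w. (w, z) \<in> r} \<subset> {w. (w, y) \<in> r}"
      proof
        show "{w. (w, z) \<in> r} \<subseteq> {w. (w, y) \<in> r}" using z r(3) by (auto dest: transD)
        have "(y, y) \<in> r" "(y, z) \<notin> r" using z r by (auto simp: refl_on_def dest: antisymD)
        then show "{w. (w, z) \<in> r} \<noteq> {w. (w, y) \<in> r}" by blast
      qed
      moreover have "finite {w. (w, y) \<in> r}"
        by (rule finite_subset[OF _ P(1)]) (use r(1) in auto)
      ultimately have "card {w. (w, z) \<in> r} < card {w. (w, y) \<in> r}"
        by (rule psubset_card_mono[rotated])
      then show "moebius Q s (f x) (f z) = moebius P r x z"
        using less.hyps z AD by auto
    qed
    finally show ?thesis
      using True inj[OF x less.prems] emb[OF x less.prems] P Q
      by (subst (1 2) moebius.simps) simp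
  qed
qed

section \<open>The annulus with one point on the inner circle\<close>

lemma map_cycle_of_list: "distinct cs \<Longrightarrow> map (cycle_of_list cs) cs = rotate1 cs"
  using cyclic_rotation[of cs 1] by simp

lemma cycle_of_list_inversion:
  assumes L: "L \<noteq> []" "distinct (map abs L)" "set L \<subseteq> signed_points N"
  defines "c \<equiv> cycle_of_list (L @ map uminus L)"
  shows "c \<in> hyperoctahedral N" "traces c L (- hd L)" "\<And>i. \<bar>i\<bar> \<notin> abs ` set L \<Longrightarrow> c i = i"
proof -
  let ?cs = "L @ map uminus L"
  have disj: "- i \<notin> set L" if "i \<in> set L" for i
    using distinct_abs_uminus[OF L(2,3) that] .
  have dist: "distinct ?cs"
    using L(2) disj by (auto simp: distinct_map inj_on_def)
  have out: "c i = i" if "i \<notin> set ?cs" for i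
    unfolding c_def using id_outside_supp[OF that] .
  have "map c L @ map c (map uminus L) = (tl L @ [- hd L]) @ (map uminus (tl L) @ [hd L])"
    using map_cycle_of_list[OF dist] L(1) unfolding c_def by (cases L) auto
  then have eq: "map c L = tl L @ [- hd L]" "map c (map uminus L) = map uminus (tl L) @ [hd L]"
    using L(1) by (subst (asm) append_eq_append_conv; cases L; simp)+
  have "map c (map uminus L) = map uminus (map c L)"
    unfolding eq by simp
  then have neg: "c (- i) = - c i" if "i \<in> set L" for i
    using that by simp
  show "traces c L (- hd L)" using L(1) eq(1) by (simp add: traces_def)
  show "c i = i" if "\<bar>i\<bar> \<notin> abs ` set L" for i
    by (rule out) (use that in force)
  have "c permutes set ?cs" unfolding c_def by (rule cycle_permutes)
  then have "c permutes signed_points N"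
    by (rule permutes_subset) (use L(3) in auto)
  moreover have "c (- i) = - c i" for i
  proof -
    consider "i \<in> set L" | "- i \<in> set L" | "i \<notin> set ?cs" "- i \<notin> set ?cs" by force
    then show ?thesis
    proof cases
      case 2
      then show ?thesis using neg[of "- i"] by simp
    qed (use neg out in auto)
  qed
  ultimately show "c \<in> hyperoctahedral N" by (simp add: hyperoctahedral_def)
qed

lemma B_gamma_one:
  assumes "m \<ge> 1"
  shows "B_gamma m 1 \<in> hyperoctahedral (m + 1)"
    "traces (B_gamma m 1) [1..int m] (- 1)" "B_gamma m 1 (int (m + 1)) = - int (m + 1)"
proof -
  let ?L = "[1..int m]" and ?K = "[int m + 1]" and ?N = "m + 1"
  let ?c = "cycle_of_list (?L @ map uminus ?L)" and ?d = "cycle_of_list (?K @ map uminus ?K)"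
  have L: "?L \<noteq> []" "distinct (map abs ?L)" "set ?L \<subseteq> signed_points ?N" "hd ?L = 1"
    using assms by (auto simp: distinct_map inj_on_def signed_points_def upto_rec1)
  have K: "?K \<noteq> []" "distinct (map abs ?K)" "set ?K \<subseteq> signed_points ?N"
    by (auto simp: signed_points_def)
  have "[int m + 1..int ?N] = ?K" by (simp add: upto_rec1)
  then have g: "B_gamma m 1 = ?c \<circ> ?d" unfolding B_gamma_def by (simp only:)
  note c = cycle_of_list_inversion[OF L(1-3)] and d = cycle_of_list_inversion[OF K]
  show "B_gamma m 1 \<in> hyperoctahedral ?N"
    unfolding g using c(1) d(1) by (rule hyperoctahedral_comp)
  have "?d i = i" if "i \<in> set ?L" for i
    using that by (intro d(3)) auto
  then have "map (?c \<circ> ?d) ?L = map ?c ?L" by (simp cong: map_cong)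
  then show "traces (B_gamma m 1) ?L (- 1)"
    using c(2) L(4) unfolding g traces_def by simp
  have "int ?N = int m + 1" by simp
  then have "?d (int ?N) = - int ?N"
    using traces_last[OF d(2)] by (simp only: last.simps list.sel if_True simp_thms)
  moreover have "?c (- int ?N) = - int ?N" by (rule c(3)) auto
  ultimately show "B_gamma m 1 (int ?N) = - int ?N"
    unfolding g comp_apply by (simp only:)
qed

lemma annular_no_fixed_vectors:
  assumes g: "g \<in> hyperoctahedral N" and L: "traces g L (- hd L)" "set L \<subseteq> signed_points N"
    and n: "g n = - n" and cover: "\<And>k. k \<in> signed_points N \<Longrightarrow> \<bar>k\<bar> \<in> abs ` set (n # L)"
  shows "fixed_vectors N g = {0}"
proof -
  have "v = 0" if v: "v \<in> fixed_vectors N g" for v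
  proof
    fix k
    have odd: "v (- k) = - v k" for k using fixed_vectorsD(1)[OF v] by (rule odd_vectorsD)
    have "L \<noteq> []" using L(1) by (simp add: traces_def)
    then have "v (hd L) = v (- hd L)" using fixed_vector_traces[OF v L(1)] by simp
    then have "v (- hd L) = 0" using odd[of "hd L"] three_eq_minus_iff[of "v (hd L)"] by simp
    then have vL: "v k = 0" if "k \<in> set L" for k using fixed_vector_traces[OF v L(1)] that by simp
    have vn: "v n = 0" using fixed_vectorsD(2)[OF v, of n] n odd[of n] three_eq_minus_iff[of "v n"] by simp
    show "v k = 0 k"
    proof (cases "k \<in> signed_points N")
      case True
      then obtain l where l: "l \<in> set (n # L)" "\<bar>k\<bar> = \<bar>l\<bar>" using cover by blast
      then have "k = l \<or> k = - l" by (simp add: abs_eq_iff)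
      moreover have "v l = 0" using l(1) vn vL by auto
      ultimately show ?thesis using odd[of l] by auto
    next
      case False
      then show ?thesis using odd_vectorsD(2)[OF fixed_vectorsD(1)[OF v]] by simp
    qed
  qed
  then show ?thesis using zero_fixed_vector by blast
qed

text \<open>Multiplying by a reflection in \<open>n\<close> and a point \<open>j\<close> of the other self-opposite cycle
  merges the two cycles into a pair of opposite cycles through all points. Reading off
  one of them from \<open>j\<close>: it runs to the end of the list, continues through the negatives
  of the points before \<open>j\<close>, and instead of reaching \<open>- j\<close> is diverted to \<open>- n\<close>, which
  leads back to \<open>j\<close>.\<close>

lemma annular_merge:
  assumes g: "g \<in> hyperoctahedral N" and L: "traces g (us @ j # vs) (- hd (us @ j # vs))"
    and pts: "set (n # us @ j # vs) \<subseteq> signed_points N" and dist: "distinct (map abs (n # us @ j # vs))"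
    and n: "g n = - n" and cover: "\<And>k. k \<in> signed_points N \<Longrightarrow> \<bar>k\<bar> \<in> abs ` set (n # us @ j # vs)"
  shows "(reflection n j, g) \<in> absolute_order N"
    "real_of_int (group_moebius N (reflection n j \<circ> g)) = moebius_A (length (n # us @ j # vs))"
proof -
  let ?t = "reflection n j" and ?xs = "(j # vs) @ map uminus us @ [- n]"
  have nj: "n \<in> signed_points N" "j \<in> signed_points N" "n \<noteq> j" and nz: "n \<noteq> 0" "j \<noteq> 0"
    using pts dist by (auto simp: signed_points_def)
  have notin: "\<bar>n\<bar> \<notin> abs ` (set us \<union> set vs)" "\<bar>j\<bar> \<notin> abs ` (set us \<union> set vs)"
    using dist by (simp_all add: image_Un)
  have other: "?t k = k" "?t (- k) = - k" if "k \<in> set us \<union> set vs" for k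
    using notin[THEN abs_notin_image, OF that] by (simp_all add: reflection_other)
  have g_neg: "g (- n) = n" using hyperoctahedralD(1)[OF g, of n] n by simp
  have last: "traces (?t \<circ> g) [- n] j" using g_neg by (simp add: traces_def)
  have tr: "traces (?t \<circ> g) ?xs (hd ?xs)"
  proof (cases "us = []")
    case True
    then have "traces g (j # vs) (- j)" using L by simp
    then have "traces (?t \<circ> g) (j # vs) (- n)"
      using traces_comp[of g "j # vs" "- j" ?t] other nz by simp
    then show ?thesis using last True traces_append[of "j # vs" "[- n]"] by simp
  next
    case False
    have "traces g (us @ (j # vs)) (- hd us)" using L False by simp
    then have tr: "traces g us j" "traces g (j # vs) (- hd us)"
      using False by (subst (asm) traces_append; simp)+
    have "traces (?t \<circ> g) (j # vs) (- hd us)"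
      using traces_comp[OF tr(2), of ?t] other False by simp
    moreover have "traces (?t \<circ> g) (map uminus us) (- n)"
    proof -
      have "?t k = k" if "k \<in> set (tl (map uminus us))" for k
        using that other list.set_sel(2)[OF False] by (auto simp: map_tl[symmetric])
      from traces_comp[OF traces_uminus[OF g tr(1)] this] show ?thesis using nz by simp
    qed
    ultimately show ?thesis
      using last False traces_append[of "map uminus us" "[- n]" "?t \<circ> g" j]
        traces_append[of "j # vs" "map uminus us @ [- n]" "?t \<circ> g" j]
      by (simp add: hd_map)
  qed
  have mset_eq: "mset (map abs ?xs) = mset (map abs (n # us @ j # vs))"
    by (simp add: comp_def)
  have dist': "distinct (map abs ?xs)"
    using dist mset_eq mset_eq_imp_distinct_iff by blast
  have set_eq: "abs ` set ?xs = abs ` set (n # us @ j # vs)"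
    using mset_eq by (metis mset_eq_setD list.set_map)
  have pts': "set ?xs \<subseteq> signed_points N" using pts by auto
  have "signed_cycles N (?t \<circ> g) [] [?xs]"
    unfolding signed_cycles_def
  proof (intro conjI allI impI)
    show tg: "?t \<circ> g \<in> hyperoctahedral N" using g nj by simp
    fix k assume k: "\<bar>k\<bar> \<notin> abs ` set ([] @ concat [?xs])"
    have "\<bar>k\<bar> \<notin> abs ` set (n # us @ j # vs)" using k unfolding set_eq[symmetric] by simp
    then have "k \<notin> signed_points N" using cover by blast
    then show "(?t \<circ> g) k = k" using hyperoctahedralD(4)[OF tg] by blast
  qed (use tr dist' pts' in simp_all)
  from group_moebius_signed_cycles[OF this]
  show "real_of_int (group_moebius N (?t \<circ> g)) = moebius_A (length (n # us @ j # vs))"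
    by (simp add: moebius_B_def add.commute)
  show "(?t, g) \<in> absolute_order N"
  proof (rule reflection_le_by_cycle[OF g nj _ tr dist' pts'])
    show "v n = v j" if "v \<in> fixed_vectors N g" for v
      using that annular_no_fixed_vectors[OF g L _ n cover] pts by auto
    have "- n \<in> set ?xs" by simp
    from distinct_abs_uminus[OF dist' pts' this]
    show "g (last ?xs) \<notin> set ?xs" using g_neg by simp
  qed
qed

text \<open>All reflections moving \<open>n\<close> are below \<open>g\<close>, since \<open>g\<close> has no fixed vector but \<open>0\<close>.
  Exchanging the roles of \<open>n\<close> and \<open>- n\<close> reduces the reflections in \<open>n\<close> and \<open>- j\<close> to
  those in \<open>n\<close> and \<open>j\<close>.\<close>

lemma group_moebius_annular:
  assumes g: "g \<in> hyperoctahedral N" and L: "traces g L (- hd L)"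
    and pts: "set (n # L) \<subseteq> signed_points N" and dist: "distinct (map abs (n # L))"
    and n: "g n = - n" and cover: "\<And>k. k \<in> signed_points N \<Longrightarrow> \<bar>k\<bar> \<in> abs ` set (n # L)"
  shows "real_of_int (group_moebius N g)
    = - (moebius_B (length L) + 2 * real (length L) * moebius_A (length L + 1))"
proof -
  let ?f = "\<lambda>i. real_of_int (group_moebius N (reflection n i \<circ> g))"
  have np: "n \<in> signed_points N" "- n \<in> signed_points N" and nz: "n \<noteq> 0" "n \<noteq> - n"
    using pts by (auto simp: signed_points_def)
  have merge: "(reflection n j, g) \<in> absolute_order N" "?f j = moebius_A (length L + 1)"
    "(reflection n (- j), g) \<in> absolute_order N" "?f (- j) = moebius_A (length L + 1)"
    if j: "j \<in> set L" for j
  proof -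
    obtain us vs where L_eq: "L = us @ j # vs" using split_list[OF j] by blast
    show "(reflection n j, g) \<in> absolute_order N" "?f j = moebius_A (length L + 1)"
      using annular_merge[OF g, of us j vs n] assms unfolding L_eq by simp_all
    have "reflection n (- j) = reflection (- n) j"
      using reflection_uminus[of n "- j"] j pts by (auto simp: signed_points_def)
    then show "(reflection n (- j), g) \<in> absolute_order N" "?f (- j) = moebius_A (length L + 1)"
      using annular_merge[OF g, of us j vs "- n"] assms hyperoctahedralD(1)[OF g, of n]
      unfolding L_eq by simp_all
  qed
  have open_n: "(reflection n (- n), g) \<in> absolute_order N" "?f (- n) = moebius_B (length L)"
  proof -
    let ?t = "reflection n (- n)"
    have nL: "\<bar>n\<bar> \<notin> abs ` set L" using dist by simp
    have tn: "traces (?t \<circ> g) [n] n" using n nz by (simp add: traces_def)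
    have "traces (?t \<circ> g) L (- hd L)"
    proof (rule traces_reflection_disjoint[OF L])
      fix k assume "k \<in> insert (- hd L) (set L)"
      moreover have "hd L \<in> set L" using L by (simp add: traces_def)
      ultimately have "\<bar>k\<bar> \<in> abs ` set L" by force
      then show "\<bar>k\<bar> \<noteq> \<bar>n\<bar> \<and> \<bar>k\<bar> \<noteq> \<bar>- n\<bar>" using nL by auto
    qed
    then have "signed_cycles N (?t \<circ> g) L [[n]]"
      unfolding signed_cycles_def
    proof (intro conjI allI impI)
      show tg: "?t \<circ> g \<in> hyperoctahedral N" using g np by simp
      fix k assume "\<bar>k\<bar> \<notin> abs ` set (L @ concat [[n]])"
      then have "k \<notin> signed_points N" using cover by auto
      then show "(?t \<circ> g) k = k" using hyperoctahedralD(4)[OF tg] by blast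
    qed (use tn dist pts in auto)
    from group_moebius_signed_cycles[OF this] show "?f (- n) = moebius_B (length L)" by simp
    show "(?t, g) \<in> absolute_order N"
    proof (rule reflection_le_by_cycle[OF g np nz(2)])
      show "v n = v (- n)" if "v \<in> fixed_vectors N g" for v
        using that annular_no_fixed_vectors[OF g L _ n cover] pts by auto
      show "traces (?t \<circ> g) [n] (hd [n])" using tn by simp
    qed (use np n nz in auto)
  qed
  have "i \<in> {i. i \<in> signed_points N \<and> i \<noteq> n \<and> (reflection n i, g) \<in> absolute_order N}
      \<longleftrightarrow> i \<in> insert (- n) (set L \<union> uminus ` set L)" for i
  proof
    assume i: "i \<in> {i. i \<in> signed_points N \<and> i \<noteq> n \<and> (reflection n i, g) \<in> absolute_order N}"
    then obtain l where "l \<in> set (n # L)" "\<bar>i\<bar> = \<bar>l\<bar>" using cover by blast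
    then show "i \<in> insert (- n) (set L \<union> uminus ` set L)"
      using i by (auto simp: abs_eq_iff)
  next
    assume i: "i \<in> insert (- n) (set L \<union> uminus ` set L)"
    then have "i \<noteq> n" using nz dist by force
    then show "i \<in> {i. i \<in> signed_points N \<and> i \<noteq> n \<and> (reflection n i, g) \<in> absolute_order N}"
      using i merge(1,3) open_n(1) pts by auto
  qed
  then have below: "{i. i \<in> signed_points N \<and> i \<noteq> n \<and> (reflection n i, g) \<in> absolute_order N}
      = insert (- n) (set L \<union> uminus ` set L)" by blast
  have dL: "distinct (map abs L)" "distinct L" using dist by (auto simp: distinct_map)
  have disj: "set L \<inter> uminus ` set L = {}"
    using distinct_abs_uminus[OF dL(1)] pts by auto
  have "\<bar>n\<bar> \<notin> abs ` set L" using dist by simp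
  from abs_notin_image[OF this, of n] abs_notin_image[OF this, of "- n"]
  have "- n \<notin> set L \<union> uminus ` set L" by auto
  then have "(\<Sum>i\<in>insert (- n) (set L \<union> uminus ` set L). ?f i)
      = ?f (- n) + ((\<Sum>i\<in>set L. ?f i) + (\<Sum>i\<in>set L. ?f (- i)))"
    using disj by (subst sum.insert) (auto simp: sum.union_disjoint sum.reindex)
  also have "\<dots> = moebius_B (length L) + 2 * real (length L) * moebius_A (length L + 1)"
    using merge(2,4) open_n(2) distinct_card[OF dL(2)] by simp
  finally show ?thesis
    using group_moebius_recursion[OF g np(1)] n nz(2) unfolding below by simp
qed

text \<open>The map \<open>Omega_tilde\<close> is an isomorphism from the interval below \<open>B_gamma p q\<close> onto the
  partition poset. Without non-zero fixed vectors the top element has a single block.\<close>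

lemma moebius_NC_B_eq_group_moebius:
  assumes pos: "p + q > 0" and g: "B_gamma p q \<in> hyperoctahedral (p + q)"
    and fix0: "fixed_vectors (p + q) (B_gamma p q) = {0}"
  shows "moebius (NC_B p q) (NC_B_order p q) (NC_B_zero p q) (NC_B_one p q)
    = group_moebius (p + q) (B_gamma p q)"
proof -
  let ?N = "p + q" and ?g = "B_gamma p q"
  have S: "S_nc_B p q = {x. (x, ?g) \<in> absolute_order ?N}"
    using g by (auto simp: S_nc_B_def absolute_order_def)
  have id_S: "id \<in> S_nc_B p q" and g_S: "?g \<in> S_nc_B p q"
    unfolding S using g by (simp_all add: absolute_order_def B_le_def)
  have "moebius (hyperoctahedral ?N) (absolute_order ?N) id ?g
    = moebius (NC_B p q) (NC_B_order p q) (Omega_tilde ?N id) (Omega_tilde ?N ?g)"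
  proof (rule moebius_order_embedding[OF finite_hyperoctahedral partial_order_absolute
        finite_NC_B partial_order_on_NC_B _ _ _ _ id_S g_S])
    show "S_nc_B p q \<subseteq> hyperoctahedral ?N" by (auto simp: S_nc_B_def)
    show "z \<in> S_nc_B p q" if "w \<in> S_nc_B p q" "(z, w) \<in> absolute_order ?N" for z w
      using that absolute_order_trans unfolding S by blast
    show "Omega_tilde ?N ` S_nc_B p q = NC_B p q" by (simp add: NC_B_def)
    show "(z, w) \<in> absolute_order ?N \<longleftrightarrow> (Omega_tilde ?N z, Omega_tilde ?N w) \<in> NC_B_order p q"
      if "z \<in> S_nc_B p q" "w \<in> S_nc_B p q" for z w
    proof -
      have zw: "(z, ?g) \<in> absolute_order ?N" "(w, ?g) \<in> absolute_order ?N" using that unfolding S by auto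
      have "(Omega_tilde ?N z, Omega_tilde ?N w) \<in> NC_B_order p q
          \<longleftrightarrow> (\<forall>A\<in>Omega_tilde ?N z. \<exists>B\<in>Omega_tilde ?N w. A \<subseteq> B)"
        using that by (simp add: NC_B_order_def NC_B_def)
      also have "\<dots> \<longleftrightarrow> fixed_vectors ?N w \<subseteq> fixed_vectors ?N z"
        by (rule Omega_tilde_refines_iff[OF absolute_orderD(1)[OF zw(1)] absolute_orderD(1)[OF zw(2)]])
      also have "\<dots> \<longleftrightarrow> (z, w) \<in> absolute_order ?N"
        using fixed_vectors_subset_imp_le[OF zw] fixed_vectors_absolute_order by blast
      finally show ?thesis ..
    qed
  qed
  moreover have "Omega_tilde ?N id = NC_B_zero p q"
  proof -
    have "fixed_block ?N id i = {i}" if i: "i \<in> signed_points ?N" for i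
    proof -
      have e: "odd_indicator {i} \<in> odd_vectors ?N"
        using i signed_points_neq(1)[OF i] by (intro odd_indicator_odd_vector) auto
      have "j = i" if "odd_indicator {i} j = odd_indicator {i} i" for j
        using that by (auto simp: odd_indicator_def split: if_splits)
      then show ?thesis using i e unfolding fixed_block_def fixed_vectors_id by blast
    qed
    then show ?thesis
      unfolding Omega_tilde_eq_fixed_blocks[OF hyperoctahedral_id] NC_B_zero_def by simp
  qed
  moreover have "Omega_tilde ?N ?g = NC_B_one p q"
  proof -
    have "int ?N \<in> signed_points ?N" using pos by (auto simp: signed_points_def)
    then show ?thesis
      unfolding Omega_tilde_eq_fixed_blocks[OF g] NC_B_one_def fixed_block_def fix0 by auto
  qed
  ultimately show ?thesis by (simp add: group_moebius_def)
qed

theorem theorem3p6: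
  fixes n :: nat
  assumes "n \<ge> 2"
  shows "real_of_int (moebius (NC_B (n - 1) 1) (NC_B_order (n - 1) 1)
            (NC_B_zero (n - 1) 1) (NC_B_one (n - 1) 1))
         = (-1) ^ n * real ((2 * n - 1) choose n) * ((5 * real n - 4) / (4 * real n - 2))"
proof -
  define m where "m = n - 1"
  have m: "m \<ge> 1" "n = m + 1" using assms by (auto simp: m_def)
  let ?g = "B_gamma m 1" and ?L = "[1..int m]" and ?n = "int (m + 1)"
  note g = B_gamma_one[OF m(1)]
  have hd: "hd ?L = 1" using m(1) by (simp add: upto_rec1)
  have L: "traces ?g ?L (- hd ?L)" using g(2) hd by simp
  have pts: "set (?n # ?L) \<subseteq> signed_points (m + 1)" by (auto simp: signed_points_def)
  have dist: "distinct (map abs (?n # ?L))" by (auto simp: distinct_map inj_on_def)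
  have cover: "\<bar>k\<bar> \<in> abs ` set (?n # ?L)" if "k \<in> signed_points (m + 1)" for k
    by (rule image_eqI[of _ _ "\<bar>k\<bar>"]) (use that in \<open>auto simp: signed_points_def\<close>)
  have "fixed_vectors (m + 1) ?g = {0}"
    using annular_no_fixed_vectors[OF g(1) L _ g(3) cover] pts by auto
  then have "real_of_int (moebius (NC_B m 1) (NC_B_order m 1) (NC_B_zero m 1) (NC_B_one m 1))
      = real_of_int (group_moebius (m + 1) ?g)"
    using moebius_NC_B_eq_group_moebius[OF _ g(1)] by simp
  also have "\<dots> = - (moebius_B m + 2 * real m * moebius_A (m + 1))"
    using group_moebius_annular[OF g(1) L pts dist g(3) cover] by simp
  also have "\<dots> = (-1) ^ n * real ((2 * n - 1) choose n) * ((5 * real n - 4) / (4 * real n - 2))"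
    using moebius_formula[OF assms] unfolding m(2) by simp
  finally show ?thesis unfolding m_def .
qed

end
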